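(* For odd $n\ge 3$, the graph $\mathcal{H}_n$ is connected.
   Context: Fix an integer $n\ge 2$ and place $2n$ points equidistantly on the unit circle. $\mathcal{M}_n$ is the set of all non-crossing straight-line perfect matchings on these $2n$ points (each has $n$ edges). For $M\in\mathcal{M}_n$, two edges $e,f\in M$ span an empty quadrilateral if the convex hull of $e$ and $f$ contains no other edge of $M$; replacing $e,f$ by the other two edges of this quadrilateral yields another matching of $\mathcal{M}_n$ (a flip). A flip is centered if the closed quadrilateral contains the center of the circle (possibly on its boundary). $\mathcal{H}_n$ is the graph with vertex set $\mathcal{M}_n$ and an edge between two matchings if they differ by a centered flip. *)

theory Defs
  imports "HOL-Analysis.Analysis" "Graph_Theory.Graph_Theory"
begin

definition circle_points :: "nat \<Rightarrow> complex set" where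
  "circle_points n = (\<lambda>k. cis (2 * pi * real k / real (2 * n))) ` {..<2 * n}"

text \<open>An edge is the set of its two endpoints; \<^term>\<open>convex hull e\<close> is the closed
  straight-line segment that it spans.\<close>

definition perfect_matching :: "nat \<Rightarrow> complex set set \<Rightarrow> bool" where
  "perfect_matching n M \<longleftrightarrow> partition_on (circle_points n) M \<and> (\<forall>e\<in>M. card e = 2)"

definition noncrossing :: "complex set set \<Rightarrow> bool" where
  "noncrossing M \<longleftrightarrow> (\<forall>e\<in>M. \<forall>f\<in>M. e \<noteq> f \<longrightarrow> convex hull e \<inter> convex hull f = {})"

definition matchings :: "nat \<Rightarrow> complex set set set" where
  "matchings n = {M. perfect_matching n M \<and> noncrossing M}"

abbreviation quadrilateral :: "complex set \<Rightarrow> complex set \<Rightarrow> complex set" where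
  "quadrilateral e f \<equiv> convex hull (e \<union> f)"

definition quad_sides :: "complex set \<Rightarrow> complex set \<Rightarrow> complex set set" where
  "quad_sides e f =
    {g. g \<subseteq> e \<union> f \<and> card g = 2 \<and> (convex hull g) edge_of (quadrilateral e f)}"

text \<open>Emptiness means that no other edge of the matching meets the quadrilateral. Inclusion of
  a whole edge would be the wrong condition: the endpoints of the other edges lie on the circle,
  hence never in the quadrilateral, whereas an edge separating \<open>e\<close> from \<open>f\<close> passes through it.\<close>

definition empty_quad :: "complex set set \<Rightarrow> complex set \<Rightarrow> complex set \<Rightarrow> bool" where
  "empty_quad M e f \<longleftrightarrow>
    e \<in> M \<and> f \<in> M \<and> e \<noteq> f \<and> (\<forall>g\<in>M - {e, f}. convex hull g \<inter> quadrilateral e f = {})"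

definition flip :: "complex set set \<Rightarrow> complex set \<Rightarrow> complex set \<Rightarrow> complex set set" where
  "flip M e f = (M - {e, f}) \<union> (quad_sides e f - {e, f})"

definition centered_flip :: "complex set set \<Rightarrow> complex set set \<Rightarrow> bool" where
  "centered_flip M M' \<longleftrightarrow>
    (\<exists>e f. empty_quad M e f \<and> 0 \<in> quadrilateral e f \<and> M' = flip M e f)"

text \<open>The arc relation is symmetric, since undoing a flip is a flip in the same quadrilateral;
  moreover \<^const>\<open>Digraph_Component.connected\<close> refers to the symmetric closure.\<close>

definition centered_flip_graph :: "nat \<Rightarrow> complex set set pair_pre_digraph" where
  "centered_flip_graph n =
    \<lparr> pverts = matchings n,
      parcs = {(M, M'). M \<in> matchings n \<and> M' \<in> matchings n \<and> centered_flip M M'} \<rparr>"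

end

theory Submission
  imports Defs
begin

text \<open>
  Let \<open>P\<close> be any finite set on the unit circle with \<open>P = - P\<close> and \<open>2 m\<close> points, \<open>m\<close> odd; connectedness is
  shown for all such \<open>P\<close> by induction on \<open>m\<close>.

  From every matching one reaches a matching that contains a diameter: take an endpoint \<open>a\<close> of a
  longest edge and keep flipping the edge at \<open>a\<close> with the nearest edge that separates \<open>a\<close> from \<open>- a\<close>.
  When no such edge is left, the edges at \<open>a\<close> and \<open>- a\<close> lie on the same side of the diameter, because
  \<open>m - 1\<close> is even, and flipping them produces \<open>{a, - a}\<close>. Two further flips turn the diameter \<open>{a, - a}\<close>
  into \<open>{b, - b}\<close>, where \<open>b\<close> is the neighbour of \<open>a\<close>; hence the diameter can be prescribed. Two other
  flips turn \<open>{a, - a}\<close> into the pair of edges \<open>{a, b}\<close>, \<open>{- a, - b}\<close>. These two edges never obstruct a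
  flip, so the induction hypothesis applies to \<open>P - {a, b, - a, - b}\<close>.
\<close>

section \<open>Angles and orientation\<close>

text \<open>The base point \<open>q\<close> is a parameter, so that the jump from
  \<open>2 * pi\<close> to 0 can be put where it does no harm, mostly at an endpoint of the diameter
  under consideration.\<close>

definition ang :: "complex \<Rightarrow> complex \<Rightarrow> real" where
  "ang q z = Arg2pi (z / q)"

lemma ang_ge_0: "0 \<le> ang q z" and ang_lt_2pi: "ang q z < 2 * pi"
  by (simp_all add: ang_def Arg2pi_ge_0 Arg2pi_lt_2pi)

lemma cis_ang:
  assumes "norm q = 1" "norm z = 1"
  shows "z = q * cis (ang q z)"
proof -
  have "norm (z / q) = 1" using assms by (simp add: norm_divide)
  then have "z / q = cis (ang q z)"
    using complex_norm_eq_1_exp[of "z / q"] by (simp add: ang_def cis_conv_exp)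
  moreover have "q \<noteq> 0" using assms by auto
  ultimately show ?thesis by (simp add: divide_eq_eq mult.commute)
qed

lemma ang_inject:
  assumes "norm q = 1" "norm x = 1" "norm y = 1"
  shows "ang q x = ang q y \<longleftrightarrow> x = y"
  using cis_ang assms by metis

lemma ang_self: "norm q = 1 \<Longrightarrow> ang q q = 0"
  by (auto simp: ang_def Arg2pi_eq_0)

lemma ang_uminus:
  assumes "norm q = 1" "norm z = 1"
  shows "ang q (- z) = (if ang q z < pi then ang q z + pi else ang q z - pi)"
proof -
  have "z / q \<noteq> 0" using assms by auto
  from Arg2pi_minus[OF this] show ?thesis by (simp add: ang_def)
qed

lemma ang_uminus_base:
  assumes "norm q = 1" "norm z = 1"
  shows "ang (- q) z = (if ang q z < pi then ang q z + pi else ang q z - pi)"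
  using ang_uminus[OF assms] by (simp add: ang_def)

text \<open>This is the cross product of \<open>b - a\<close> and \<open>c - a\<close>, twice the
  signed area of the triangle: positive for a counterclockwise turn.\<close>

definition orient :: "complex \<Rightarrow> complex \<Rightarrow> complex \<Rightarrow> real" where
  "orient a b c = Im (cnj (b - a) * (c - a))"

lemma orient_rotate: "orient b c a = orient a b c"
  and orient_swap: "orient b a c = - orient a b c"
  and orient_self: "orient a b a = 0" "orient a b b = 0"
  by (simp_all add: orient_def algebra_simps)

text \<open>In half angles both sides become polynomials in sines and cosines. The product form
  makes the sign of the area of an inscribed triangle visible.\<close>

lemma sin_add_sin_minus_sin:
  fixes x y :: real
  shows "sin x + sin y - sin (x + y) = 4 * sin (x / 2) * sin (y / 2) * sin ((x + y) / 2)"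
proof -
  define u v where "u = x / 2" and "v = y / 2"
  have xy: "x = u + u" "y = v + v" "(x + y) / 2 = u + v" by (simp_all add: u_def v_def)
  have c: "cos w * cos w = 1 - sin w * sin w" for w :: real
    using sin_cos_squared_add[of w] by (simp add: power2_eq_square)
  have "sin x + sin y - sin (x + y) = 2 * sin u * cos u * (1 - (cos v * cos v - sin v * sin v))
      + 2 * sin v * cos v * (1 - (cos u * cos u - sin u * sin u))"
    unfolding xy(1,2) sin_add cos_add by algebra
  also have "\<dots> = 4 * sin u * sin v * (sin u * cos v + cos u * sin v)"
    unfolding c by algebra
  finally show ?thesis unfolding xy(3) sin_add[of u v] by (simp add: u_def v_def)
qed

text \<open>Multiplication by \<open>q\<close> is a rotation and preserves areas; what remains is
  the classical area formula for a triangle with circumradius 1.\<close>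

lemma orient_cis:
  assumes "norm q = 1"
  shows "orient (q * cis x) (q * cis y) (q * cis z) =
    4 * sin ((y - x) / 2) * sin ((z - y) / 2) * sin ((z - x) / 2)"
proof -
  have "cnj q * q = 1" using assms by (simp add: mult.commute complex_norm_square[symmetric])
  moreover have "cnj (q * cis y - q * cis x) * (q * cis z - q * cis x)
      = (cnj q * q) * (cnj (cis y - cis x) * (cis z - cis x))"
    by (simp add: algebra_simps)
  ultimately have "orient (q * cis x) (q * cis y) (q * cis z) = Im (cnj (cis y - cis x) * (cis z - cis x))"
    unfolding orient_def by simp
  also have "\<dots> = sin (y - x) + sin (z - y) - sin ((y - x) + (z - y))"
    by (simp add: sin_diff algebra_simps)
  finally show ?thesis by (simp only: sin_add_sin_minus_sin) (simp add: algebra_simps)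
qed

lemma orient_pos:
  assumes "norm q = 1" "norm x = 1" "norm y = 1" "norm z = 1"
    and "ang q x < ang q y" "ang q y < ang q z"
  shows "orient x y z > 0"
proof -
  \<comment> \<open>Angle differences lie between 0 and \<open>2 * pi\<close>, so their halves lie
    where the sine is positive.\<close>
  have s: "sin ((u - v) / 2) > 0" if "v < u" "0 \<le> v" "u < 2 * pi" for u v :: real
    using that by (intro sin_gt_zero) auto
  have "orient x y z = orient (q * cis (ang q x)) (q * cis (ang q y)) (q * cis (ang q z))"
    using assms cis_ang by metis
  also have "\<dots> > 0"
    unfolding orient_cis[OF assms(1)] using assms(5,6) ang_ge_0[of q] ang_lt_2pi[of q]
    by (intro mult_pos_pos s) (auto intro: less_trans)
  finally show ?thesis .
qed

text \<open>Symmetric in \<open>x\<close> and \<open>y\<close>, so that the endpoints of a chord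
  need no order. Of the two open arcs cut off by the chord it selects the one that never contains
  angle 0.\<close>

definition in_arc :: "real \<Rightarrow> real \<Rightarrow> real \<Rightarrow> bool" where
  "in_arc x y z \<longleftrightarrow> x < z \<and> z < y \<or> y < z \<and> z < x"

text \<open>After sorting by angle, \<open>orient_pos\<close> applies. Cyclic shifts keep the sign,
  and \<open>z\<close> between the other two costs one transposition.\<close>

lemma orient_in_arc:
  assumes "norm q = 1" "norm x = 1" "norm y = 1" "norm z = 1"
    and "ang q x < ang q y" "z \<noteq> x" "z \<noteq> y"
  shows "if in_arc (ang q x) (ang q y) (ang q z) then orient x y z < 0 else orient x y z > 0"
proof -
  have "ang q z \<noteq> ang q x" "ang q z \<noteq> ang q y" using assms ang_inject by metis+
  then consider "ang q z < ang q x" | "ang q x < ang q z" "ang q z < ang q y" | "ang q y < ang q z"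
    by linarith
  then show ?thesis
  proof cases
    case 1
    have "orient z x y > 0" by (rule orient_pos[OF assms(1,4,2,3) 1 assms(5)])
    then have "orient x y z > 0" by (simp only: orient_rotate[of x y z])
    then show ?thesis using 1 assms(5) by (simp add: in_arc_def)
  next
    case 2
    have "orient x z y > 0" by (rule orient_pos[OF assms(1,2,4,3) 2])
    then have "orient x y z < 0"
      using orient_rotate[of x z y] orient_swap[of y x z] by linarith
    then show ?thesis using 2 by (simp add: in_arc_def)
  next
    case 3
    have "orient x y z > 0" by (rule orient_pos[OF assms(1,2,3,4) assms(5) 3])
    then show ?thesis using 3 assms(5) by (simp add: in_arc_def)
  qed
qed

lemma orient_affine:
  assumes "u + v = 1"
  shows "orient a b (u *\<^sub>R x + v *\<^sub>R y) = u * orient a b x + v * orient a b y"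
proof -
  have v: "v = 1 - u" using assms by simp
  show ?thesis unfolding v orient_def by (simp add: algebra_simps)
qed

lemma convex_orient_pos: "convex {z. orient a b z > 0}"
  unfolding convex_def
proof (intro ballI allI impI)
  fix x y u v assume *: "x \<in> {z. orient a b z > 0}" "y \<in> {z. orient a b z > 0}"
    "0 \<le> u" "0 \<le> v" "u + v = (1::real)"
  then have "u * orient a b x + v * orient a b y > 0"
    by (cases "u = 0") (auto intro!: add_pos_nonneg)
  then show "u *\<^sub>R x + v *\<^sub>R y \<in> {z. orient a b z > 0}" using * by (simp add: orient_affine)
qed

lemma hull_orient_pos:
  assumes "\<And>z. z \<in> S \<Longrightarrow> orient a b z > 0" "z \<in> convex hull S"
  shows "orient a b z > 0"
  using hull_minimal[of S "{z. orient a b z > 0}" convex] convex_orient_pos assms by auto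

lemma hull_pair_orient_0:
  assumes "z \<in> affine hull {a, b}"
  shows "orient a b z = 0"
  using assms by (auto simp: affine_hull_2 orient_affine orient_self)

text \<open>All of \<open>S\<close> lies in one open half-plane bounded by the line, and half-planes
  are convex. The conclusion is about the whole line because the face criterion in
  \<open>quad_sides_eq\<close> asks for the affine hull.\<close>

lemma chord_hull_disjoint:
  assumes "norm q = 1" "norm x = 1" "norm y = 1" "x \<noteq> y" "S \<subseteq> sphere 0 1" "x \<notin> S" "y \<notin> S"
    and same: "\<And>z w. z \<in> S \<Longrightarrow> w \<in> S \<Longrightarrow>
      in_arc (ang q x) (ang q y) (ang q z) \<longleftrightarrow> in_arc (ang q x) (ang q y) (ang q w)"
  shows "affine hull {x, y} \<inter> convex hull S = {}"
proof -
  have *: "affine hull {x, y} \<inter> convex hull S = {}"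
    if "norm x = 1" "norm y = 1" "ang q x < ang q y" "x \<notin> S" "y \<notin> S"
      and same: "\<And>z w. z \<in> S \<Longrightarrow> w \<in> S \<Longrightarrow>
      in_arc (ang q x) (ang q y) (ang q z) \<longleftrightarrow> in_arc (ang q x) (ang q y) (ang q w)" for x y
  proof (cases "\<exists>z\<in>S. in_arc (ang q x) (ang q y) (ang q z)")
    case True
    \<comment> \<open>Here \<open>S\<close> is on the negative side; exchanging the endpoints makes
      the sign positive.\<close>
    then have "orient y x z > 0" if "z \<in> S" for z
    proof -
      have "norm z = 1" "z \<noteq> x" "z \<noteq> y"
        using that \<open>S \<subseteq> sphere 0 1\<close> \<open>x \<notin> S\<close> \<open>y \<notin> S\<close> by auto
      moreover have "in_arc (ang q x) (ang q y) (ang q z)" using that True same by blast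
      ultimately show ?thesis using orient_in_arc[OF \<open>norm q = 1\<close> \<open>norm x = 1\<close> \<open>norm y = 1\<close> _ \<open>ang q x < ang q y\<close>, of z]
        by (simp add: orient_swap[of y x])
    qed
    then have "orient y x z > 0" if "z \<in> convex hull S" for z
      using hull_orient_pos that by blast
    moreover have "orient y x z = 0" if "z \<in> affine hull {x, y}" for z
      using hull_pair_orient_0[OF that] orient_swap[of y x z] by simp
    ultimately show ?thesis by fastforce
  next
    case False
    then have "orient x y z > 0" if "z \<in> S" for z
    proof -
      have "norm z = 1" "z \<noteq> x" "z \<noteq> y" "\<not> in_arc (ang q x) (ang q y) (ang q z)"
        using that False \<open>S \<subseteq> sphere 0 1\<close> \<open>x \<notin> S\<close> \<open>y \<notin> S\<close> by auto
      with orient_in_arc[OF \<open>norm q = 1\<close> \<open>norm x = 1\<close> \<open>norm y = 1\<close> _ \<open>ang q x < ang q y\<close>, of z]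
      show ?thesis by simp
    qed
    then have "orient x y z > 0" if "z \<in> convex hull S" for z
      using hull_orient_pos that by blast
    then show ?thesis using hull_pair_orient_0 by fastforce
  qed
  have "ang q x \<noteq> ang q y" using ang_inject[OF assms(1-3)] assms(4) by simp
  then consider "ang q x < ang q y" | "ang q y < ang q x" by linarith
  then show ?thesis
  proof cases
    case 1
    show ?thesis by (rule *[OF assms(2,3) 1 assms(6,7) same])
  next
    case 2
    have sym: "in_arc (ang q y) (ang q x) = in_arc (ang q x) (ang q y)" by (auto simp: in_arc_def)
    have "affine hull {y, x} \<inter> convex hull S = {}"
      by (rule *[OF assms(3,2) 2 assms(7,6)]) (unfold sym, rule same)
    then show ?thesis by (simp only: insert_commute[of x])
  qed
qed

section \<open>Crossing diagonals and triangles around the centre\<close>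

lemma diagonals_meet:
  assumes "orient x y z > 0" "orient y z w > 0" "orient z w x > 0" "orient w x y > 0"
  shows "\<exists>p. p \<in> open_segment x z \<and> p \<in> open_segment y w"
proof -
  \<comment> \<open>Each constant is twice the area of the triangle omitting one vertex:
    \<open>A\<close> omits \<open>x\<close>, \<open>B\<close> omits \<open>z\<close>,
    \<open>C\<close> omits \<open>y\<close>, \<open>D\<close> omits \<open>w\<close>. They are the
    coefficients of the affine dependence of four points in the plane, which exhibits one point on
    both diagonals. Both \<open>A + B\<close> and \<open>C + D\<close> are twice the area of the
    quadrilateral.\<close>
  define A B C D where "A = orient y z w" and "B = orient w x y" and "C = orient z w x" and "D = orient x y z"
  have pos: "A > 0" "B > 0" "C > 0" "D > 0" using assms by (simp_all add: A_def B_def C_def D_def)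
  have sum: "A + B = C + D" unfolding A_def B_def C_def D_def orient_def by (simp add: algebra_simps)
  have eq: "A *\<^sub>R x + B *\<^sub>R z = C *\<^sub>R y + D *\<^sub>R w"
    unfolding A_def B_def C_def D_def orient_def by (simp add: complex_eq_iff algebra_simps)
  have ne: "x \<noteq> z" "y \<noteq> w" using assms by (auto simp: orient_self)
  let ?p = "(1 - B / (A + B)) *\<^sub>R x + (B / (A + B)) *\<^sub>R z"
  have 1: "?p \<in> open_segment x z"
    using ne pos by (auto simp: in_segment intro!: exI[of _ "B / (A + B)"])
  have c: "1 - B / (A + B) = A / (A + B)" "1 - D / (C + D) = C / (C + D)" using pos by (simp_all add: field_simps)
  have "?p = (1 / (A + B)) *\<^sub>R (A *\<^sub>R x + B *\<^sub>R z)" unfolding c by (simp add: scaleR_add_right)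
  also have "\<dots> = (1 / (C + D)) *\<^sub>R (C *\<^sub>R y + D *\<^sub>R w)" unfolding eq sum ..
  also have "\<dots> = (1 - D / (C + D)) *\<^sub>R y + (D / (C + D)) *\<^sub>R w" unfolding c by (simp add: scaleR_add_right)
  also have "\<dots> \<in> open_segment y w"
    using ne pos by (auto simp: in_segment intro!: exI[of _ "D / (C + D)"])
  finally show ?thesis using 1 by blast
qed

lemma diagonals_meet_ang:
  assumes "norm q = 1" "norm x = 1" "norm y = 1" "norm z = 1" "norm w = 1"
    and "ang q x < ang q y" "ang q y < ang q z" "ang q z < ang q w"
  shows "\<exists>p. p \<in> open_segment x z \<and> p \<in> open_segment y w"
proof (rule diagonals_meet)
  note less = assms(6-8) less_trans[OF assms(6,7)] less_trans[OF assms(7,8)]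
  show "orient x y z > 0" by (rule orient_pos[OF assms(1-4) less(1,2)])
  show "orient y z w > 0" by (rule orient_pos[OF assms(1,3,4,5) less(2,3)])
  have "orient x z w > 0" by (rule orient_pos[OF assms(1,2,4,5) less(4,3)])
  then show "orient z w x > 0" by (simp only: orient_rotate[of z w x])
  have "orient x y w > 0" by (rule orient_pos[OF assms(1,2,3,5) less(1,5)])
  then show "orient w x y > 0" by (simp only: orient_rotate[of x y w])
qed

lemma zero_in_triangle:
  assumes "0 < y - x" "y - x < pi" "0 \<le> z - y" "z - y \<le> pi" "pi \<le> z - x"
  shows "0 \<in> convex hull {q * cis x, q * cis y, q * cis z}"
proof -
  \<comment> \<open>Sines of the central angles opposite the vertices are, up to scaling, the
    barycentric coordinates of the centre. For \<open>B\<close> this angle is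
    \<open>2 * pi - (z - x)\<close>, whence the minus sign. \<open>C > 0\<close> makes the sum
    positive.\<close>
  define A B C where "A = sin (z - y)" and "B = - sin (z - x)" and "C = sin (y - x)"
  have C: "C > 0" using assms by (auto simp: C_def intro: sin_gt_zero)
  have A: "A \<ge> 0" using assms by (auto simp: A_def intro: sin_ge_zero)
  have "sin (z - x - pi) \<ge> 0" using assms by (intro sin_ge_zero) auto
  then have B: "B \<ge> 0" by (simp add: B_def sin_diff)
  let ?s = "A + B + C"
  have s: "?s > 0" using A B C by simp
  have "A *\<^sub>R cis x + B *\<^sub>R cis y + C *\<^sub>R cis z = 0"
  proof (rule complex_eqI)
    have "A * cos x + B * cos y + C * cos z = 0"
      unfolding A_def B_def C_def sin_diff by algebra
    then show "Re (A *\<^sub>R cis x + B *\<^sub>R cis y + C *\<^sub>R cis z) = Re 0" by simp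
    have "A * sin x + B * sin y + C * sin z = 0"
      unfolding A_def B_def C_def sin_diff by algebra
    then show "Im (A *\<^sub>R cis x + B *\<^sub>R cis y + C *\<^sub>R cis z) = Im 0" by simp
  qed
  then have "0 = (1 / ?s) *\<^sub>R (q * (A *\<^sub>R cis x + B *\<^sub>R cis y + C *\<^sub>R cis z))"
    by (simp only: mult_zero_right scaleR_zero_right)
  also have "\<dots> = (A / ?s) *\<^sub>R (q * cis x) + (B / ?s) *\<^sub>R (q * cis y) + (C / ?s) *\<^sub>R (q * cis z)"
    by (simp only: distrib_left scaleR_add_right mult_scaleR_right scaleR_scaleR times_divide_eq_left mult_1)
  finally have "0 = (A / ?s) *\<^sub>R (q * cis x) + (B / ?s) *\<^sub>R (q * cis y) + (C / ?s) *\<^sub>R (q * cis z)" .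
  moreover have "A / ?s + B / ?s + C / ?s = 1" using s by (simp flip: add_divide_distrib)
  moreover have "A / ?s \<ge> 0" "B / ?s \<ge> 0" "C / ?s \<ge> 0" using A B C s by auto
  ultimately show ?thesis unfolding convex_hull_3 by blast
qed

section \<open>Chords and quadrilaterals\<close>

lemma hull_subset_affine: "convex hull {x, y} \<subseteq> affine hull {x, y :: complex}"
  by (rule convex_hull_subset_affine_hull)

text \<open>The four endpoints alternate around the circle, so the chords are the diagonals of an
  inscribed quadrilateral; the cases tell whether \<open>w\<close> comes first or last by
  angle.\<close>

lemma chords_meet:
  assumes "norm q = 1" "norm x = 1" "norm y = 1" "norm z = 1" "norm w = 1"
    and "ang q x < ang q y" "x \<noteq> w" "y \<noteq> w"
    and "in_arc (ang q x) (ang q y) (ang q z)" "\<not> in_arc (ang q x) (ang q y) (ang q w)"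
  shows "convex hull {x, y} \<inter> convex hull {z, w} \<noteq> {}"
proof -
  have "ang q w \<noteq> ang q x" "ang q w \<noteq> ang q y" using assms ang_inject by metis+
  then consider "ang q w < ang q x" "ang q x < ang q z" "ang q z < ang q y"
    | "ang q x < ang q z" "ang q z < ang q y" "ang q y < ang q w"
    using assms(6,9,10) by (fastforce simp: in_arc_def)
  then have "\<exists>p. p \<in> open_segment x y \<and> p \<in> open_segment z w"
  proof cases
    case 1
    from diagonals_meet_ang[OF assms(1,5,2,4,3) this] show ?thesis
      by (auto simp: open_segment_commute)
  next
    case 2
    from diagonals_meet_ang[OF assms(1,2,4,3,5) this] show ?thesis .
  qed
  then show ?thesis
    by (auto simp: segment_convex_hull[symmetric] dest: open_closed_segment)
qed

lemma in_arc_commute: "in_arc x y = in_arc y x"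
  by (auto simp: in_arc_def)

text \<open>Turns noncrossing into comparisons of angles, for any base point \<open>q\<close>. One
  direction separates by a line, the other finds the crossing point of alternating chords.\<close>

lemma chords_disjoint_iff:
  assumes "norm q = 1" "norm x = 1" "norm y = 1" "norm z = 1" "norm w = 1" "x \<noteq> y"
  shows "convex hull {x, y} \<inter> convex hull {z, w} = {} \<longleftrightarrow>
    x \<noteq> z \<and> x \<noteq> w \<and> y \<noteq> z \<and> y \<noteq> w \<and>
    (in_arc (ang q x) (ang q y) (ang q z) \<longleftrightarrow> in_arc (ang q x) (ang q y) (ang q w))"
    (is "?L \<longleftrightarrow> ?R")
proof
  assume ?R
  then have "affine hull {x, y} \<inter> convex hull {z, w} = {}"
    using assms by (intro chord_hull_disjoint[of q]) auto
  then show ?L using hull_subset_affine by blast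
next
  assume L: ?L
  have "{x, y} \<inter> {z, w} = {}"
    using L hull_subset[of "{x, y}" convex] hull_subset[of "{z, w}" convex] by blast
  then have ne: "x \<noteq> z" "x \<noteq> w" "y \<noteq> z" "y \<noteq> w" by auto
  have m: "convex hull {x, y} \<inter> convex hull {z, w} \<noteq> {}"
    if "norm z = 1" "norm w = 1" "x \<noteq> w" "y \<noteq> w" "in_arc (ang q x) (ang q y) (ang q z)"
      "\<not> in_arc (ang q x) (ang q y) (ang q w)" for z w
  proof -
    have "ang q x \<noteq> ang q y" using ang_inject[OF assms(1-3)] assms(6) by simp
    then consider "ang q x < ang q y" | "ang q y < ang q x" by linarith
    then show ?thesis
    proof cases
      case 1
      show ?thesis by (rule chords_meet[OF assms(1-3) that(1,2) 1 that(3-6)])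
    next
      case 2
      have "convex hull {y, x} \<inter> convex hull {z, w} \<noteq> {}"
        by (rule chords_meet[OF assms(1,3,2) that(1,2) 2 that(4,3)])
          (use that(5,6) in \<open>simp_all only: in_arc_commute[of "ang q y" "ang q x"] not_False_eq_True\<close>)
      then show ?thesis unfolding insert_commute[of x y "{}"] .
    qed
  qed
  have "in_arc (ang q x) (ang q y) (ang q z) \<longleftrightarrow> in_arc (ang q x) (ang q y) (ang q w)"
    using m[OF assms(4,5) ne(2,4)] m[OF assms(5,4) ne(1,3)] L
    by (metis insert_commute)
  with ne show ?R by blast
qed

text \<open>The line through two neighbouring corners leaves the other two on one side, so it
  carries a face; a diagonal is no face since the other diagonal crosses it. Only
  \<open>e \<union> f\<close> is prescribed, so \<open>e\<close> and \<open>f\<close> may be either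
  pair of opposite sides.\<close>

lemma quad_sides_eq:
  assumes "norm q = 1" "norm a = 1" "norm b = 1" "norm c = 1" "norm d = 1"
    and "ang q a < ang q b" "ang q b < ang q c" "ang q c < ang q d"
    and ef: "e \<union> f = {a, b, c, d}"
  shows "quad_sides e f = {{a, b}, {b, c}, {c, d}, {d, a}}"
proof -
  let ?Q = "{a, b, c, d}"
  have d: "a \<noteq> b" "a \<noteq> c" "a \<noteq> d" "b \<noteq> c" "b \<noteq> d" "c \<noteq> d" using assms by auto
  have side: "(convex hull {x, y}) edge_of (convex hull ?Q)"
    if "x \<in> ?Q" "y \<in> ?Q" "x \<noteq> y"
      and imp: "\<And>z w. z \<in> ?Q - {x, y} \<Longrightarrow> w \<in> ?Q - {x, y} \<Longrightarrow>
        in_arc (ang q x) (ang q y) (ang q z) \<Longrightarrow> in_arc (ang q x) (ang q y) (ang q w)" for x y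
  proof -
    have "affine hull {x, y} \<inter> convex hull (?Q - {x, y}) = {}"
    proof (rule chord_hull_disjoint[of q])
      show "in_arc (ang q x) (ang q y) (ang q z) \<longleftrightarrow> in_arc (ang q x) (ang q y) (ang q w)"
        if "z \<in> ?Q - {x, y}" "w \<in> ?Q - {x, y}" for z w using that imp by blast
    qed (use that(1-3) assms in auto)
    moreover have "{x, y} \<subseteq> ?Q" using that(1,2) by blast
    ultimately have "(convex hull {x, y}) face_of (convex hull ?Q)"
      by (intro face_of_convex_hulls) auto
    then show ?thesis using that(3) by (simp add: edge_of_def aff_dim_convex_hull aff_dim_2)
  qed
  have ab: "(convex hull {a, b}) edge_of (convex hull ?Q)"
    and bc: "(convex hull {b, c}) edge_of (convex hull ?Q)"
    and cd: "(convex hull {c, d}) edge_of (convex hull ?Q)"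
    and da: "(convex hull {d, a}) edge_of (convex hull ?Q)"
    by (rule side; use assms(6-8) d in \<open>auto simp: in_arc_def\<close>)+
  obtain p where p: "p \<in> open_segment a c" "p \<in> open_segment b d"
    using diagonals_meet_ang[OF assms(1-8)] by blast
  \<comment> \<open>A face containing \<open>p\<close>, a point between \<open>y\<close> and
    \<open>w\<close>, must contain \<open>y\<close>. But then \<open>y\<close> lies strictly between
    two points of the circle, where the norm is below 1.\<close>
  have diag: "\<not> (convex hull {x, z}) face_of (convex hull ?Q)"
    if "p \<in> open_segment x z" "p \<in> open_segment y w" "y \<in> ?Q" "w \<in> ?Q" "y \<notin> {x, z}"
      "norm x = 1" "norm z = 1" "norm y = 1" for x y z w
  proof
    assume "(convex hull {x, z}) face_of (convex hull ?Q)"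
    moreover have "p \<in> convex hull {x, z}"
      using that(1) by (simp add: open_closed_segment flip: segment_convex_hull)
    moreover have "y \<in> convex hull ?Q" "w \<in> convex hull ?Q" using that(3,4) by (auto intro: hull_inc)
    ultimately have "y \<in> convex hull {x, z}" using that(2) face_ofD by blast
    then have "y \<in> open_segment x z" using that(5) by (simp add: open_segment_def segment_convex_hull)
    then have "norm y < 1"
      using that(6,7) different_norm_3_collinear_points[of y x z] that(8) by simp
    then show False using that(8) by simp
  qed
  have ac: "\<not> (convex hull {a, c}) edge_of (convex hull ?Q)"
    using diag[of a c b d] p d assms by (auto simp: edge_of_def)
  have bd: "\<not> (convex hull {b, d}) edge_of (convex hull ?Q)"
    using diag[of b d a c] p d assms by (auto simp: edge_of_def)
  have "g \<in> quad_sides e f \<longleftrightarrow> g \<in> {{a, b}, {b, c}, {c, d}, {d, a}}" for g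
  proof
    assume "g \<in> quad_sides e f"
    then have g: "g \<subseteq> ?Q" "card g = 2" "(convex hull g) edge_of (convex hull ?Q)"
      by (auto simp: quad_sides_def ef)
    from g(2) obtain x y where xy: "g = {x, y}" "x \<noteq> y" by (auto simp: card_2_iff)
    with g(1) have "x \<in> ?Q" "y \<in> ?Q" by auto
    with xy have "g \<in> {{a, b}, {b, c}, {c, d}, {d, a}, {a, c}, {b, d}}"
      by (elim insertE emptyE) (simp_all add: insert_commute)
    moreover have "g \<noteq> {a, c}" "g \<noteq> {b, d}" using g(3) ac bd by metis+
    ultimately show "g \<in> {{a, b}, {b, c}, {c, d}, {d, a}}" by simp
  next
    assume "g \<in> {{a, b}, {b, c}, {c, d}, {d, a}}"
    then consider "g = {a, b}" | "g = {b, c}" | "g = {c, d}" | "g = {d, a}" by blast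
    then show "g \<in> quad_sides e f"
      unfolding quad_sides_def ef by cases (use ab bc cd da d in simp_all)
  qed
  then show ?thesis by blast
qed

section \<open>Noncrossing matchings of an arbitrary point set and their flips\<close>

definition nc_matching :: "complex set \<Rightarrow> complex set set \<Rightarrow> bool" where
  "nc_matching P M \<longleftrightarrow> \<Union>M = P \<and> (\<forall>e\<in>M. card e = 2) \<and> noncrossing M"

lemma nc_matching_disjoint:
  assumes "nc_matching P M" "e \<in> M" "f \<in> M" "e \<noteq> f"
  shows "e \<inter> f = {}"
proof -
  have "convex hull e \<inter> convex hull f = {}"
    using assms unfolding nc_matching_def noncrossing_def by blast
  then show ?thesis using hull_subset[of e convex] hull_subset[of f convex] by blast
qed

text \<open>Disjointness of the edges follows from disjointness of their hulls, and
  \<open>card e = 2\<close> excludes an empty block; so the union condition already yields a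
  partition. With the point set as a parameter, the induction can delete points.\<close>

lemma matchings_iff: "M \<in> matchings n \<longleftrightarrow> nc_matching (circle_points n) M"
proof
  assume "M \<in> matchings n"
  then show "nc_matching (circle_points n) M"
    by (auto simp: matchings_def perfect_matching_def nc_matching_def partition_on_def)
next
  assume *: "nc_matching (circle_points n) M"
  have "disjoint M"
    unfolding disjoint_def using nc_matching_disjoint[OF *] by blast
  moreover have "{} \<notin> M" using * by (auto simp: nc_matching_def)
  ultimately show "M \<in> matchings n" using *
    by (auto simp: matchings_def perfect_matching_def nc_matching_def partition_on_def)
qed

definition flip_step :: "complex set \<Rightarrow> complex set set \<Rightarrow> complex set set \<Rightarrow> bool" where
  "flip_step P M M' \<longleftrightarrow> nc_matching P M \<and> nc_matching P M' \<and> centered_flip M M'"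

lemma nc_matching_edge:
  assumes "nc_matching P M" "P \<subseteq> sphere 0 1" "norm q = 1" "e \<in> M"
  obtains u v where "e = {u, v}" "ang q u < ang q v" "u \<in> P" "v \<in> P"
proof -
  obtain u v where e: "e = {u, v}" "u \<noteq> v"
    using assms by (auto simp: nc_matching_def card_2_iff)
  then have P: "u \<in> P" "v \<in> P" using assms by (auto simp: nc_matching_def)
  then have "norm u = 1" "norm v = 1" using assms by auto
  then have "ang q u \<noteq> ang q v" using ang_inject[OF assms(3)] e by blast
  then consider "ang q u < ang q v" | "ang q v < ang q u" by linarith
  then show thesis using that e P by cases (auto simp: insert_commute)
qed

lemma nc_matching_in:
  assumes "nc_matching P M" "{u, v} \<in> M"
  shows "u \<in> P" "v \<in> P" "u \<noteq> v"
  using assms by (auto simp: nc_matching_def)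

lemma nc_matching_partner:
  assumes "nc_matching P M" "u \<in> P"
  obtains v where "{u, v} \<in> M"
proof -
  obtain e where e: "e \<in> M" "u \<in> e" using assms by (auto simp: nc_matching_def)
  then have "card e = 2" using assms by (auto simp: nc_matching_def)
  then obtain x y where "e = {x, y}" by (auto simp: card_2_iff)
  with e that show thesis by (metis insert_commute insert_iff singletonD)
qed

text \<open>The emptiness checks for the flips below reduce to this angular form of
  noncrossing.\<close>

lemma nc_matching_disj:
  assumes M: "nc_matching P M" "P \<subseteq> sphere 0 1" and q: "norm q = 1"
    and e: "{u, v} \<in> M" "{x, y} \<in> M" "{u, v} \<noteq> {x, y}"
  shows "u \<noteq> x \<and> u \<noteq> y \<and> v \<noteq> x \<and> v \<noteq> y \<and>
    (in_arc (ang q u) (ang q v) (ang q x) \<longleftrightarrow> in_arc (ang q u) (ang q v) (ang q y))"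
proof -
  have "convex hull {u, v} \<inter> convex hull {x, y} = {}"
    using M e by (auto simp: nc_matching_def noncrossing_def)
  moreover have "norm u = 1" "norm v = 1" "norm x = 1" "norm y = 1" "u \<noteq> v"
    using nc_matching_in[OF M(1) e(1)] nc_matching_in[OF M(1) e(2)] M(2) by auto
  ultimately show ?thesis using chords_disjoint_iff[OF q] by blast
qed

lemma flip_step_quad:
  assumes M: "nc_matching P M" and P: "P \<subseteq> sphere 0 1" and q: "norm q = 1"
    and abcd: "ang q a < ang q b" "ang q b < ang q c" "ang q c < ang q d"
    and E: "E = {{a, b}, {c, d}} \<and> E' = {{b, c}, {d, a}} \<or> E = {{b, c}, {d, a}} \<and> E' = {{a, b}, {c, d}}"
    and EM: "E \<subseteq> M"
    \<comment> \<open>Comparing two opposite corners suffices, since no edge of \<open>M\<close> crosses an edge of \<open>E\<close>.\<close>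
    and sep: "\<And>u v. {u, v} \<in> M - E \<Longrightarrow> ang q u < ang q v \<Longrightarrow>
      in_arc (ang q u) (ang q v) (ang q a) \<longleftrightarrow> in_arc (ang q u) (ang q v) (ang q c)"
    and zero: "0 \<in> convex hull {a, b, c, d}"
  shows "flip_step P M (M - E \<union> E')"
proof -
  let ?Q = "{a, b, c, d}"
  have UE: "\<Union>E = ?Q" "\<Union>E' = ?Q" using E by auto
  have QP: "?Q \<subseteq> P" unfolding UE(1)[symmetric] using EM M by (auto simp: nc_matching_def)
  then have n: "norm a = 1" "norm b = 1" "norm c = 1" "norm d = 1" using P by auto
  have d: "a \<noteq> b" "a \<noteq> c" "a \<noteq> d" "b \<noteq> c" "b \<noteq> d" "c \<noteq> d" using abcd by auto
  \<comment> \<open>An edge of \<open>E\<close> has both its corners on the same side of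
    \<open>g\<close>, and \<open>sep\<close> links \<open>a\<close> with \<open>c\<close>, so all
    four corners are on one side. This yields both the emptiness of the quadrilateral and the
    disjointness of old edges from new ones, which lie inside it.\<close>
  have apart: "convex hull g \<inter> convex hull ?Q = {}" if "g \<in> M - E" for g
  proof -
    have gM: "g \<in> M" using that by blast
    obtain u v where g: "g = {u, v}" "ang q u < ang q v" "u \<in> P" "v \<in> P"
      by (rule nc_matching_edge[OF M P q gM])
    have nx: "u \<noteq> x \<and> u \<noteq> y \<and> v \<noteq> x \<and> v \<noteq> y \<and>
      (in_arc (ang q u) (ang q v) (ang q x) \<longleftrightarrow> in_arc (ang q u) (ang q v) (ang q y))"
      if "{x, y} \<in> E" for x y
    proof (rule nc_matching_disj[OF M P q])
      show "{u, v} \<in> M" "{x, y} \<in> M" "{u, v} \<noteq> {x, y}" using that \<open>g \<in> M - E\<close> g(1) EM by auto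
    qed
    have ac: "in_arc (ang q u) (ang q v) (ang q a) \<longleftrightarrow> in_arc (ang q u) (ang q v) (ang q c)"
      using sep that g by blast
    let ?I = "\<lambda>z. in_arc (ang q u) (ang q v) (ang q z)"
    have *: "u \<notin> ?Q \<and> v \<notin> ?Q \<and>
      (in_arc (ang q u) (ang q v) (ang q b) \<longleftrightarrow> in_arc (ang q u) (ang q v) (ang q a)) \<and>
      (in_arc (ang q u) (ang q v) (ang q c) \<longleftrightarrow> in_arc (ang q u) (ang q v) (ang q a)) \<and>
      (in_arc (ang q u) (ang q v) (ang q d) \<longleftrightarrow> in_arc (ang q u) (ang q v) (ang q a))"
      using E
    proof (elim disjE conjE)
      assume "E = {{a, b}, {c, d}}"
      with nx[of a b] nx[of c d] have "?I a \<longleftrightarrow> ?I b" "?I c \<longleftrightarrow> ?I d" "u \<notin> ?Q" "v \<notin> ?Q" by simp_all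
      with ac show ?thesis by simp
    next
      assume "E = {{b, c}, {d, a}}"
      with nx[of b c] nx[of d a] have "?I b \<longleftrightarrow> ?I c" "?I d \<longleftrightarrow> ?I a" "u \<notin> ?Q" "v \<notin> ?Q" by simp_all
      with ac show ?thesis by simp
    qed
    then have *: "u \<notin> ?Q" "v \<notin> ?Q"
      and eq: "\<And>z. z \<in> ?Q \<Longrightarrow> in_arc (ang q u) (ang q v) (ang q z) \<longleftrightarrow> in_arc (ang q u) (ang q v) (ang q a)"
      by blast+
    have **: "in_arc (ang q u) (ang q v) (ang q z) \<longleftrightarrow> in_arc (ang q u) (ang q v) (ang q w)"
      if "z \<in> ?Q" "w \<in> ?Q" for z w using eq[OF that(1)] eq[OF that(2)] by simp
    have uv: "norm u = 1" "norm v = 1" "u \<noteq> v" using g P by auto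
    have "?Q \<subseteq> sphere 0 1" using QP P by blast
    from chord_hull_disjoint[OF q uv this * **]
    have "affine hull {u, v} \<inter> convex hull ?Q = {}" .
    then show ?thesis using hull_subset_affine[of u v] unfolding g(1) by blast
  qed
  obtain e f where ef: "E = {e, f}" "e \<noteq> f" "e \<union> f = ?Q" "e \<in> M" "f \<in> M"
  proof -
    have "{a, b} \<noteq> {c, d}" "{b, c} \<noteq> {d, a}" using d by (auto simp: doubleton_eq_iff)
    moreover have "{a, b} \<union> {c, d} = ?Q" "{b, c} \<union> {d, a} = ?Q" by auto
    moreover have "E = {{a, b}, {c, d}} \<or> E = {{b, c}, {d, a}}" using E by blast
    ultimately show thesis using that EM by (elim disjE) simp_all
  qed
  have "empty_quad M e f"
    unfolding empty_quad_def ef(3) using ef(2,4,5) apart[unfolded ef(1)] by blast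
  moreover have "flip M e f = M - E \<union> E'"
  proof -
    have ne: "{a, b} \<noteq> {b, c}" "{a, b} \<noteq> {d, a}" "{c, d} \<noteq> {b, c}" "{c, d} \<noteq> {d, a}"
      using d by (simp_all add: doubleton_eq_iff)
    have "E' = {{a, b}, {b, c}, {c, d}, {d, a}} - E"
      using E ne ne[symmetric] by (elim disjE conjE) (simp_all add: insert_Diff_if)
    then show ?thesis
      unfolding flip_def quad_sides_eq[OF q n abcd ef(3)] ef(1) by simp
  qed
  ultimately have "centered_flip M (M - E \<union> E')"
    unfolding centered_flip_def by (intro exI[of _ e] exI[of _ f]) (simp add: ef(3) zero)
  moreover have "nc_matching P (M - E \<union> E')"
    unfolding nc_matching_def
  proof (intro conjI)
    have "\<Union>(M - E \<union> E') = \<Union>(M - E) \<union> \<Union>E" using UE by auto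
    also have "\<dots> = \<Union>M" using EM by blast
    also have "\<dots> = P" using M by (simp add: nc_matching_def)
    finally show "\<Union>(M - E \<union> E') = P" .
    show "\<forall>e\<in>M - E \<union> E'. card e = 2"
    proof
      fix e assume "e \<in> M - E \<union> E'"
      moreover have "\<forall>e\<in>E'. card e = 2" using E d by (elim disjE conjE) simp_all
      ultimately show "card e = 2" using M unfolding nc_matching_def by blast
    qed
    have sub: "convex hull g \<subseteq> convex hull ?Q" if "g \<in> E'" for g
      using UE(2) that by (intro hull_mono) blast
    have 1: "convex hull {a, b} \<inter> convex hull {c, d} = {}"
      using abcd d by (subst chords_disjoint_iff[OF q n]) (auto simp: in_arc_def)
    have 2: "convex hull {b, c} \<inter> convex hull {d, a} = {}"
      using abcd d by (subst chords_disjoint_iff[OF q n(2,3,4,1)]) (auto simp: in_arc_def)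
    have in_E': "convex hull g \<inter> convex hull h = {}" if "g \<in> E'" "h \<in> E'" "g \<noteq> h" for g h
    proof -
      obtain x y where "E' = {x, y}" "convex hull x \<inter> convex hull y = {}" using E 1 2 by metis
      with that show ?thesis by (metis Int_commute insertE singletonD)
    qed
    show "noncrossing (M - E \<union> E')"
      unfolding noncrossing_def
    proof (intro ballI impI)
      fix g h assume gh: "g \<in> M - E \<union> E'" "h \<in> M - E \<union> E'" "g \<noteq> h"
      consider "g \<in> M - E" "h \<in> M - E" | "g \<in> M - E" "h \<in> E'" | "g \<in> E'" "h \<in> M - E" | "g \<in> E'" "h \<in> E'"
        using gh by blast
      then show "convex hull g \<inter> convex hull h = {}"
      proof cases
        case 1
        then show ?thesis using gh(3) M by (auto simp: nc_matching_def noncrossing_def)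
      next
        case 2
        then show ?thesis using apart sub by blast
      next
        case 3
        then show ?thesis using apart sub by blast
      next
        case 4
        then show ?thesis using in_E' gh(3) by blast
      qed
    qed
  qed
  ultimately show ?thesis using M by (simp add: flip_step_def)
qed

section \<open>Moving and opening a diameter\<close>

text \<open>Equal spacing is lost when four points are deleted, while symmetry about the centre
  survives; so the induction runs over these sets.\<close>

definition antipodal :: "complex set \<Rightarrow> bool" where
  "antipodal P \<longleftrightarrow> finite P \<and> P \<subseteq> sphere 0 1 \<and> (\<forall>z\<in>P. - z \<in> P)"

lemma antipodal_norm: "antipodal P \<Longrightarrow> z \<in> P \<Longrightarrow> norm z = 1"
  by (auto simp: antipodal_def)

lemma ang_minus: "ang (- q) z = ang q (- z)"
  by (simp add: ang_def)

lemma zero_in_hull: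
  assumes "a \<in> S" "- a \<in> S"
  shows "0 \<in> convex hull (S :: complex set)"
proof -
  have "0 = (1/2) *\<^sub>R a + (1/2) *\<^sub>R (- a)" by simp
  also have "\<dots> \<in> convex hull S"
    using assms by (intro convexD[OF convex_convex_hull]) (auto intro: hull_inc)
  finally show ?thesis .
qed

lemma equivclp_trans: "equivclp r x y \<Longrightarrow> equivclp r y z \<Longrightarrow> equivclp r x z"
  by (rule transpD[OF transp_equivclp])

text \<open>Paths are taken in the symmetric closure, as in the connectedness of digraphs. The
  assumption on \<open>M\<close> covers the empty path.\<close>

lemma nc_matching_equivclp:
  assumes "equivclp (flip_step P) M N" "nc_matching P M"
  shows "nc_matching P N"
  using assms by (induction rule: equivclp_induct) (auto simp: flip_step_def)

text \<open>\<open>b\<close> is the counterclockwise neighbour of \<open>a\<close>. The bound by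
  \<open>pi\<close> keeps it away from \<open>- a\<close>, so that \<open>a\<close>,
  \<open>b\<close>, \<open>- a\<close>, \<open>- b\<close> are four points.\<close>

definition next_point :: "complex set \<Rightarrow> complex \<Rightarrow> complex \<Rightarrow> bool" where
  "next_point P a b \<longleftrightarrow> a \<in> P \<and> b \<in> P \<and> 0 < ang a b \<and> ang a b < pi \<and>
    (\<forall>z\<in>P. z \<noteq> a \<longrightarrow> ang a b \<le> ang a z)"

lemma next_point_exists:
  assumes P: "antipodal P" and a: "a \<in> P" and "P \<noteq> {a, - a}"
  obtains b where "next_point P a b"
proof -
  have na: "norm a = 1" using P a antipodal_norm by blast
  have "- a \<in> P" using P a by (auto simp: antipodal_def)
  then obtain z where z: "z \<in> P" "z \<noteq> a" "z \<noteq> - a" using assms by auto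
  have fin: "finite (P - {a})" "P - {a} \<noteq> {}" using P z by (auto simp: antipodal_def)
  define b where "b = arg_min_on (ang a) (P - {a})"
  have b: "b \<in> P - {a}" "\<And>w. w \<in> P - {a} \<Longrightarrow> ang a b \<le> ang a w"
    using arg_min_if_finite[OF fin, of "ang a"] unfolding b_def by (auto simp: not_less)
  have "ang a b \<noteq> ang a a" using ang_inject[OF na _ na] b(1) antipodal_norm[OF P] by blast
  then have "0 < ang a b" using ang_self[OF na] ang_ge_0[of a b] by linarith
  \<comment> \<open>One of \<open>z\<close> and \<open>- z\<close> lies on the open half circle
    after \<open>a\<close>, and \<open>b\<close> comes no later.\<close>
  moreover have "ang a b < pi"
  proof -
    have nz: "norm z = 1" "norm (- z) = 1" using z P antipodal_norm by auto
    have "ang a z \<noteq> ang a (- a)" using ang_inject[OF na nz(1), of "- a"] z na by auto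
    then have "ang a z \<noteq> pi" using ang_uminus[OF na na] ang_self[OF na] by simp
    then have "ang a z < pi \<or> ang a (- z) < pi"
      using ang_uminus[OF na nz(1)] ang_lt_2pi[of a z] by auto
    moreover have "- z \<in> P - {a}" "z \<in> P - {a}" using z P by (auto simp: antipodal_def)
    ultimately show ?thesis using b(2) by fastforce
  qed
  ultimately show thesis using that a b by (auto simp: next_point_def)
qed

text \<open>The half turn maps \<open>P\<close> to itself, so \<open>- b\<close> follows
  \<open>- a\<close>. The last part says that the arcs from \<open>a\<close> to \<open>b\<close> and
  from \<open>- a\<close> to \<open>- b\<close> contain no further point: minimality of
  \<open>b\<close> is applied to \<open>z\<close> and to \<open>- z\<close>.\<close>

lemma next_point_ang:
  assumes "antipodal P" "next_point P a b"
  shows "norm a = 1" "norm b = 1" "ang a a = 0" "ang a (- a) = pi" "ang a (- b) = ang a b + pi"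
    and "- a \<in> P" "- b \<in> P" "next_point P (- a) (- b)"
    and "z \<in> P \<Longrightarrow> z \<noteq> a \<Longrightarrow> z \<noteq> b \<Longrightarrow> z \<noteq> - a \<Longrightarrow> z \<noteq> - b \<Longrightarrow>
      ang a b < ang a z \<and> ang a z < pi \<or> ang a b + pi < ang a z"
proof -
  have ab: "a \<in> P" "b \<in> P" "0 < ang a b" "ang a b < pi" "\<And>z. z \<in> P \<Longrightarrow> z \<noteq> a \<Longrightarrow> ang a b \<le> ang a z"
    using assms by (auto simp: next_point_def)
  have n: "norm z = 1" if "z \<in> P" for z using that assms antipodal_norm by blast
  have neg: "- z \<in> P" if "z \<in> P" for z using that assms by (auto simp: antipodal_def)
  show a: "norm a = 1" and b: "norm b = 1" using n ab by auto
  show aa: "ang a a = 0" using ang_self[OF a] .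
  show am: "ang a (- a) = pi" using ang_uminus[OF a a] aa by simp
  show bm: "ang a (- b) = ang a b + pi" using ang_uminus[OF a b] ab by simp
  show "- a \<in> P" "- b \<in> P" using ab neg by auto
  show "next_point P (- a) (- b)"
    unfolding next_point_def ang_minus
  proof (intro conjI ballI impI)
    fix z assume "z \<in> P" "z \<noteq> - a"
    then have "- z \<in> P" "- z \<noteq> a" using neg by auto
    then show "ang a (- (- b)) \<le> ang a (- z)" using ab(5) by simp
  qed (use ab neg in auto)
  assume z: "z \<in> P" "z \<noteq> a" "z \<noteq> b" "z \<noteq> - a" "z \<noteq> - b"
  have nz: "norm z = 1" using n z by blast
  have "ang a b \<noteq> ang a z" "ang a z \<noteq> pi" "ang a z \<noteq> ang a b + pi"
    using ang_inject[OF a b nz] ang_inject[OF a nz, of "- a"] ang_inject[OF a nz, of "- b"] z a b am bm by auto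
  moreover have "ang a b \<le> ang a z" using ab(5) z by blast
  moreover have "ang a b \<le> ang a (- z)" using ab(5)[of "- z"] z(1,4) neg by (metis minus_minus)
  ultimately show "ang a b < ang a z \<and> ang a z < pi \<or> ang a b + pi < ang a z"
    using ang_uminus[OF a nz] by (auto split: if_splits)
qed

text \<open>The diameter forces \<open>c\<close> onto the half circle of \<open>b\<close>, so
  \<open>{- a, a}\<close> and \<open>{b, c}\<close> are opposite sides of a quadrilateral that has
  the centre on its boundary. An edge with \<open>c\<close> on its arc has \<open>b\<close> there
  too, so it starts at \<open>a\<close>, which is already matched to \<open>- a\<close>.\<close>

lemma open_diameter:
  assumes P: "antipodal P" and M: "nc_matching P M" and ab: "next_point P a b"
    and D: "{a, - a} \<in> M" and c: "{b, c} \<in> M"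
  shows "ang a b < ang a c" "ang a c < pi"
    and "flip_step P M (M - {{b, c}, {- a, a}} \<union> {{a, b}, {c, - a}})"
    and "\<And>u v. {u, v} \<in> M - {{b, c}, {- a, a}} \<Longrightarrow> ang a u < ang a v \<Longrightarrow>
      \<not> in_arc (ang a u) (ang a v) (ang a c)"
proof -
  note nx = next_point_ang[OF P ab]
  have PS: "P \<subseteq> sphere 0 1" using P by (simp add: antipodal_def)
  have b: "0 < ang a b" "ang a b < pi" using ab by (auto simp: next_point_def)
  have ne: "a \<noteq> b" "b \<noteq> - a" using b nx(3,4) by auto
  have "{a, - a} \<noteq> {b, c}" using ne by (auto simp: doubleton_eq_iff)
  from nc_matching_disj[OF M PS nx(1) D c this]
  have c1: "c \<noteq> a" "c \<noteq> - a" "0 < ang a c" "ang a c < pi"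
    using b nx(3,4) by (auto simp: in_arc_def)
  have cP: "c \<in> P" "c \<noteq> b" using nc_matching_in[OF M c] by auto
  have "c \<noteq> - b" using c1(4) nx(5) b by auto
  then show cb: "ang a b < ang a c" and cpi: "ang a c < pi" using nx(9)[of c] cP c1 by auto
  show sep: "\<not> in_arc (ang a u) (ang a v) (ang a c)"
    if uv: "{u, v} \<in> M - {{b, c}, {- a, a}}" "ang a u < ang a v" for u v
  proof -
    have "{u, v} \<in> M" "{u, v} \<noteq> {b, c}" "{u, v} \<noteq> {a, - a}" using uv by (auto simp: insert_commute)
    from nc_matching_disj[OF M PS nx(1) this(1) c this(2)] nc_matching_disj[OF M PS nx(1) this(1) D this(3)]
    have "u \<noteq> a" "in_arc (ang a u) (ang a v) (ang a b) \<longleftrightarrow> in_arc (ang a u) (ang a v) (ang a c)" by auto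
    moreover have "ang a b \<le> ang a u"
      using ab nc_matching_in(1)[OF M \<open>{u, v} \<in> M\<close>] \<open>u \<noteq> a\<close> by (auto simp: next_point_def)
    ultimately show ?thesis using uv(2) by (auto simp: in_arc_def)
  qed
  show "flip_step P M (M - {{b, c}, {- a, a}} \<union> {{a, b}, {c, - a}})"
  proof (rule flip_step_quad[OF M PS nx(1)])
    show "ang a a < ang a b" "ang a b < ang a c" "ang a c < ang a (- a)" using b cb cpi nx(3,4) by auto
    show "{{b, c}, {- a, a}} \<subseteq> M" using c D by (simp add: insert_commute)
    show "0 \<in> convex hull {a, b, c, - a}" by (rule zero_in_hull[of a]) auto
    show "in_arc (ang a u) (ang a v) (ang a a) = in_arc (ang a u) (ang a v) (ang a c)"
      if "{u, v} \<in> M - {{b, c}, {- a, a}}" "ang a u < ang a v" for u v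
      using sep[OF that] that(2) ang_ge_0[of a u] nx(3) by (auto simp: in_arc_def)
  qed simp
qed

text \<open>The same picture at \<open>- a\<close>, still in angles from \<open>a\<close> so that
  \<open>c\<close> and \<open>d\<close> can be compared. An edge with \<open>- b\<close> on its arc
  cannot cross the diameter, so it starts no earlier than \<open>- a\<close> and before
  \<open>- b\<close>; only \<open>- a\<close> is there, and it is taken.\<close>

lemma opposite_partner:
  assumes P: "antipodal P" and M: "nc_matching P M" and ab: "next_point P a b"
    and D: "{a, - a} \<in> M" and d: "{- b, d} \<in> M"
  shows "ang a b + pi < ang a d"
    and "\<And>u v. {u, v} \<in> M - {{- b, d}, {- a, a}} \<Longrightarrow> ang a u < ang a v \<Longrightarrow>
      \<not> in_arc (ang a u) (ang a v) (ang a (- b))"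
proof -
  note nx = next_point_ang[OF P ab]
  have PS: "P \<subseteq> sphere 0 1" using P by (simp add: antipodal_def)
  have b: "0 < ang a b" "ang a b < pi" using ab by (auto simp: next_point_def)
  have ne: "a \<noteq> - b" "b \<noteq> a" using b nx(3,5) by auto
  then have "{a, - a} \<noteq> {- b, d}" by (auto simp: doubleton_eq_iff)
  from nc_matching_disj[OF M PS nx(1) D d this]
  have d1: "d \<noteq> a" "d \<noteq> - a" "\<not> in_arc 0 pi (ang a d)"
    using b nx(3,4,5) by (auto simp: in_arc_def)
  have dP: "d \<in> P" "d \<noteq> - b" using nc_matching_in[OF M d] by auto
  have "d \<noteq> b" using d1 b by (auto simp: in_arc_def)
  then show "ang a b + pi < ang a d" using nx(9)[of d] dP d1 b by (auto simp: in_arc_def)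
  show "\<not> in_arc (ang a u) (ang a v) (ang a (- b))"
    if uv: "{u, v} \<in> M - {{- b, d}, {- a, a}}" "ang a u < ang a v" for u v
  proof
    assume in_arc: "in_arc (ang a u) (ang a v) (ang a (- b))"
    have uvM: "{u, v} \<in> M" "{u, v} \<noteq> {- b, d}" "{a, - a} \<noteq> {u, v}" using uv by (auto simp: insert_commute)
    from nc_matching_disj[OF M PS nx(1) D uvM(1) uvM(3)]
    have *: "u \<noteq> a" "u \<noteq> - a" "in_arc 0 pi (ang a u) \<longleftrightarrow> in_arc 0 pi (ang a v)" using nx(3,4) by auto
    from nc_matching_disj[OF M PS nx(1) uvM(1) d uvM(2)] have "u \<noteq> - b" by auto
    have "ang a u < ang a b + pi" "ang a b + pi < ang a v" using in_arc uv(2) nx(5) by (auto simp: in_arc_def)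
    with *(3) b ang_ge_0[of a u] have "ang a u = 0 \<or> pi \<le> ang a u" by (auto simp: in_arc_def)
    moreover have "0 < ang a u" using ab nc_matching_in(1)[OF M uvM(1)] *(1) by (fastforce simp: next_point_def)
    ultimately have "pi \<le> ang a u" by simp
    moreover have "u \<noteq> b" using calculation b by auto
    ultimately show False
      using nx(9)[of u] nc_matching_in(1)[OF M uvM(1)] * \<open>u \<noteq> - b\<close> \<open>ang a u < ang a b + pi\<close> by auto
  qed
qed

text \<open>First the diameter opens into \<open>{a, b}\<close> and \<open>{c, - a}\<close>; then
  \<open>{a, b}\<close> and \<open>{- b, d}\<close> become \<open>{b, - b}\<close> and
  \<open>{d, a}\<close>. The second quadrilateral is centered since \<open>b\<close> and
  \<open>- b\<close> are among its corners.\<close>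

lemma rotate_diameter:
  assumes P: "antipodal P" and M: "nc_matching P M" and ab: "next_point P a b" and D: "{a, - a} \<in> M"
  obtains N where "equivclp (flip_step P) M N" "{b, - b} \<in> N"
proof -
  note nx = next_point_ang[OF P ab]
  have PS: "P \<subseteq> sphere 0 1" using P by (simp add: antipodal_def)
  have b: "0 < ang a b" "ang a b < pi" "b \<in> P" using ab by (auto simp: next_point_def)
  obtain c where c: "{b, c} \<in> M" by (rule nc_matching_partner[OF M b(3)])
  obtain d where d: "{- b, d} \<in> M" by (rule nc_matching_partner[OF M nx(7)])
  note op = open_diameter[OF P M ab D c] and opp = opposite_partner[OF P M ab D d]
  define M1 where "M1 = M - {{b, c}, {- a, a}} \<union> {{a, b}, {c, - a}}"
  have M1: "flip_step P M M1" using op(3) by (simp add: M1_def)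
  then have ncM1: "nc_matching P M1" by (simp add: flip_step_def)
  have "flip_step P M1 (M1 - {{a, b}, {- b, d}} \<union> {{b, - b}, {d, a}})"
  proof (rule flip_step_quad[OF ncM1 PS nx(1)])
    show "ang a a < ang a b" "ang a b < ang a (- b)" "ang a (- b) < ang a d"
      using b nx(3,5) opp(1) by auto
    have "ang a (- b) \<noteq> ang a b" "ang a (- b) \<noteq> ang a c" "ang a (- b) \<noteq> ang a a" "ang a (- b) \<noteq> ang a (- a)"
      using nx(3-5) b op(2) by auto
    then have "{- b, d} \<noteq> {b, c}" "{- b, d} \<noteq> {- a, a}" by (metis doubleton_eq_iff)+
    with d show "{{a, b}, {- b, d}} \<subseteq> M1" by (simp add: M1_def)
    show "0 \<in> convex hull {a, b, - b, d}" by (rule zero_in_hull[of b]) auto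
    fix u v assume uv: "{u, v} \<in> M1 - {{a, b}, {- b, d}}" "ang a u < ang a v"
    \<comment> \<open>Of the edges made by the first flip only \<open>{c, - a}\<close> is concerned,
      and its angles are at most \<open>pi\<close>, short of \<open>- b\<close>. The others are
      old.\<close>
    have "\<not> in_arc (ang a u) (ang a v) (ang a (- b))"
    proof (cases "{u, v} = {c, - a}")
      case True
      then have "ang a v \<le> pi" using op(2) nx(4) by (auto simp: doubleton_eq_iff)
      then show ?thesis using uv(2) nx(5) b by (auto simp: in_arc_def)
    next
      case False
      then show ?thesis using uv opp(2) by (auto simp: M1_def)
    qed
    then show "in_arc (ang a u) (ang a v) (ang a a) = in_arc (ang a u) (ang a v) (ang a (- b))"
      using uv(2) ang_ge_0[of a u] nx(3) by (auto simp: in_arc_def)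
  qed simp
  with M1 have "equivclp (flip_step P) M (M1 - {{a, b}, {- b, d}} \<union> {{b, - b}, {d, a}})"
    by (meson equivclp_trans r_into_equivclp)
  then show thesis by (rule that) simp
qed

text \<open>The last hypothesis says that the triangle \<open>c, - a, d\<close> contains the centre; if it fails, it holds
  after exchanging \<open>a, b, c\<close> with \<open>- a, - b, d\<close>.\<close>

lemma close_ears:
  assumes P: "antipodal P" and M: "nc_matching P M" and ab: "next_point P a b"
    and D: "{a, - a} \<in> M" and c: "{b, c} \<in> M" and d: "{- b, d} \<in> M"
    and cd: "ang a c + pi \<le> ang a d"
  obtains N where "equivclp (flip_step P) M N" "{a, b} \<in> N" "{- a, - b} \<in> N"
proof -
  note nx = next_point_ang[OF P ab]
  have PS: "P \<subseteq> sphere 0 1" using P by (simp add: antipodal_def)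
  have b: "0 < ang a b" "ang a b < pi" "b \<in> P" using ab by (auto simp: next_point_def)
  note op = open_diameter[OF P M ab D c] and opp = opposite_partner[OF P M ab D d]
  define M1 where "M1 = M - {{b, c}, {- a, a}} \<union> {{a, b}, {c, - a}}"
  have M1: "flip_step P M M1" using op(3) by (simp add: M1_def)
  then have ncM1: "nc_matching P M1" by (simp add: flip_step_def)
  have ne: "ang a (- b) \<noteq> ang a b" "ang a (- b) \<noteq> ang a c" "ang a (- b) \<noteq> ang a a" "ang a (- b) \<noteq> ang a (- a)"
    using nx(3-5) b op(2) by auto
  \<comment> \<open>The second flip happens among \<open>c\<close>, \<open>- a\<close>,
    \<open>- b\<close>, \<open>d\<close>, so the edge \<open>{a, b}\<close> made by the first one
    stays.\<close>
  have "flip_step P M1 (M1 - {{c, - a}, {- b, d}} \<union> {{- a, - b}, {d, c}})"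
  proof (rule flip_step_quad[OF ncM1 PS nx(1)])
    show "ang a c < ang a (- a)" "ang a (- a) < ang a (- b)" "ang a (- b) < ang a d"
      using b nx(4,5) opp(1) op(1,2) by auto
    from ne have "{- b, d} \<noteq> {b, c}" "{- b, d} \<noteq> {- a, a}" by (metis doubleton_eq_iff)+
    with d show "{{c, - a}, {- b, d}} \<subseteq> M1" by (simp add: M1_def)
    have cd': "norm c = 1" "norm d = 1" "norm (- a) = 1"
      using nc_matching_in[OF M c] nc_matching_in[OF M d] PS nx(1) by auto
    \<comment> \<open>The arcs from \<open>c\<close> to \<open>- a\<close> and from
      \<open>- a\<close> to \<open>d\<close> are at most \<open>pi\<close>, and \<open>cd\<close>
      bounds the arc from \<open>d\<close> on to \<open>c\<close>.\<close>
    have "0 \<in> convex hull {a * cis (ang a c), a * cis (ang a (- a)), a * cis (ang a d)}"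
      using op(1,2) b nx(4) opp(1) cd ang_lt_2pi[of a d] by (intro zero_in_triangle) auto
    then have "0 \<in> convex hull {c, - a, d}"
      unfolding cis_ang[OF nx(1) cd'(1), symmetric] cis_ang[OF nx(1) cd'(2), symmetric]
        cis_ang[OF nx(1) cd'(3), symmetric] .
    moreover have "convex hull {c, - a, d} \<subseteq> convex hull {c, - a, - b, d}" by (rule hull_mono) auto
    ultimately show "0 \<in> convex hull {c, - a, - b, d}" by blast
    fix u v assume uv: "{u, v} \<in> M1 - {{c, - a}, {- b, d}}" "ang a u < ang a v"
    show "in_arc (ang a u) (ang a v) (ang a c) = in_arc (ang a u) (ang a v) (ang a (- b))"
    proof (cases "{u, v} = {a, b}")
      case True
      then have "ang a u \<le> ang a b" "ang a v \<le> ang a b" using b nx(3) by (auto simp: doubleton_eq_iff)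
      then show ?thesis using nx(5) b op(1) by (auto simp: in_arc_def)
    next
      case False
      with uv(1) have uv': "{u, v} \<in> M - {{- b, d}, {- a, a}}" "{u, v} \<in> M - {{b, c}, {- a, a}}"
        unfolding M1_def by blast+
      show ?thesis using opp(2)[OF uv'(1) uv(2)] op(4)[OF uv'(2) uv(2)] by simp
    qed
  qed simp
  with M1 have "equivclp (flip_step P) M (M1 - {{c, - a}, {- b, d}} \<union> {{- a, - b}, {d, c}})"
    by (meson equivclp_trans r_into_equivclp)
  moreover have "a \<noteq> c" "a \<noteq> - a" "a \<noteq> - b" "b \<noteq> - b"
    using ne(1,3) op(1) b(1) nx(3,4) by (metis less_irrefl less_trans, metis pi_neq_zero, metis, metis)
  then have "{a, b} \<noteq> {c, - a}" "{a, b} \<noteq> {- b, d}" by (simp_all add: doubleton_eq_iff)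
  then have "{a, b} \<in> M1 - {{c, - a}, {- b, d}} \<union> {{- a, - b}, {d, c}}" by (simp add: M1_def)
  ultimately show thesis by (rule that) simp
qed

lemma diameter_to_ears:
  assumes P: "antipodal P" and M: "nc_matching P M" and ab: "next_point P a b" and D: "{a, - a} \<in> M"
  obtains N where "equivclp (flip_step P) M N" "{a, b} \<in> N" "{- a, - b} \<in> N"
proof -
  note nx = next_point_ang[OF P ab]
  have b: "b \<in> P" using ab by (auto simp: next_point_def)
  obtain c where c: "{b, c} \<in> M" by (rule nc_matching_partner[OF M b(1)])
  obtain d where d: "{- b, d} \<in> M" by (rule nc_matching_partner[OF M nx(7)])
  show thesis
  proof (cases "ang a c + pi \<le> ang a d")
    case True
    from close_ears[OF P M ab D c d this] that show thesis by blast
  next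
    \<comment> \<open>Measuring from \<open>- a\<close> shifts the angles of \<open>c\<close> and
      \<open>d\<close> by \<open>pi\<close> in opposite directions, which turns the failed
      inequality into the required one with the ends exchanged.\<close>
    case False
    have "norm c = 1" "norm d = 1"
      using nc_matching_in[OF M c] nc_matching_in[OF M d] antipodal_norm[OF P] by auto
    then have "ang (- a) c = ang a c + pi" "ang (- a) d = ang a d - pi"
      using ang_uminus_base[OF nx(1)] open_diameter(2)[OF P M ab D c] opposite_partner(1)[OF P M ab D d]
        ang_ge_0[of a b] by auto
    then have "ang (- a) d + pi \<le> ang (- a) c" using False by simp
    moreover have "{- a, - (- a)} \<in> M" "{- (- b), c} \<in> M" using D c by (simp_all add: insert_commute)
    ultimately obtain N where "equivclp (flip_step P) M N" "{- a, - b} \<in> N" "{- (- a), - (- b)} \<in> N"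
      using close_ears[OF P M nx(8) _ d] by blast
    then show thesis using that by simp
  qed
qed

section \<open>Reaching a diameter\<close>

lemma finite_nc_matching: "finite P \<Longrightarrow> nc_matching P M \<Longrightarrow> finite M"
  by (auto simp: nc_matching_def intro: finite_UnionD)

lemma even_card_Union:
  assumes P: "finite P" and M: "nc_matching P M" and N: "N \<subseteq> M"
  shows "even (card (\<Union>N))"
proof -
  have "finite N" using finite_nc_matching[OF P M] N finite_subset by blast
  have two: "card e = 2" if "e \<in> N" for e using that M N by (auto simp: nc_matching_def)
  have "card (\<Union>N) = sum card N"
  proof (rule card_Union_disjoint)
    show "pairwise disjnt N"
      unfolding pairwise_def disjnt_def using nc_matching_disjoint[OF M] N by blast
    show "finite e" if "e \<in> N" for e using two[OF that] by (auto intro: card_ge_0_finite)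
  qed
  also have "\<dots> = (\<Sum>e\<in>N. 2)" using two by simp
  finally show ?thesis by simp
qed

text \<open>The half turn carries the open half circle after \<open>a\<close> onto the opposite one;
  the points are these two halves together with \<open>a\<close> and \<open>- a\<close>.\<close>

lemma card_half_circle:
  assumes P: "antipodal P" "a \<in> P" and m: "card P = 2 * m"
  shows "card {w \<in> P. 0 < ang a w \<and> ang a w < pi} = m - 1"
proof -
  let ?L = "{w \<in> P. 0 < ang a w \<and> ang a w < pi}"
  have n: "norm z = 1" if "z \<in> P" for z using that P antipodal_norm by blast
  have neg: "- z \<in> P" if "z \<in> P" for z using that P by (auto simp: antipodal_def)
  have na: "norm a = 1" using n P by blast
  note aa = ang_self[OF na] and um = ang_uminus[OF na]
  have fin: "finite ?L" using P by (simp add: antipodal_def)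
  have am: "ang a (- a) = pi" using um[OF na] aa by simp
  have other: "z = a \<or> z = - a \<or> z \<in> ?L \<or> z \<in> uminus ` ?L" if z: "z \<in> P" for z
  proof -
    consider "ang a z = 0" | "0 < ang a z" "ang a z < pi" | "ang a z = pi" | "pi < ang a z"
      using ang_ge_0[of a z] by linarith
    then show ?thesis
    proof cases
      case 1
      then show ?thesis using ang_inject[OF na n[OF z] na] aa by simp
    next
      case 2
      then show ?thesis using z by simp
    next
      case 3
      then show ?thesis using ang_inject[OF na n[OF z], of "- a"] am na by simp
    next
      case 4
      then have "- z \<in> ?L" using um[OF n[OF z]] ang_lt_2pi[of a z] neg[OF z] by simp
      then have "- (- z) \<in> uminus ` ?L" by (rule imageI)
      then show ?thesis by simp
    qed
  qed
  have "P = {a, - a} \<union> (?L \<union> uminus ` ?L)"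
  proof
    show "P \<subseteq> {a, - a} \<union> (?L \<union> uminus ` ?L)" using other by blast
    show "{a, - a} \<union> (?L \<union> uminus ` ?L) \<subseteq> P" using P(2) neg by blast
  qed
  moreover have big: "pi < ang a z" if "z \<in> uminus ` ?L" for z
  proof -
    from that obtain w where "z = - w" "w \<in> ?L" by blast
    then show ?thesis using um[of w] n[of w] by simp
  qed
  moreover have "{a, - a} \<inter> (?L \<union> uminus ` ?L) = {}"
  proof -
    have "a \<notin> ?L" "- a \<notin> ?L" using aa am by auto
    moreover have "a \<notin> uminus ` ?L" "- a \<notin> uminus ` ?L" using big[of a] big[of "- a"] aa am by auto
    ultimately show ?thesis by blast
  qed
  moreover have "?L \<inter> uminus ` ?L = {}" using big by fastforce
  ultimately have "card P = card {a, - a} + card (?L \<union> uminus ` ?L)"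
    "card (?L \<union> uminus ` ?L) = card ?L + card (uminus ` ?L)"
    using fin card_Un_disjoint[of "{a, - a}" "?L \<union> uminus ` ?L"] card_Un_disjoint[of ?L "uminus ` ?L"]
    by auto
  moreover have "card (uminus ` ?L) = card ?L" by (intro card_image) auto
  moreover have "a \<noteq> - a" using aa am by auto
  then have "card {a, - a} = 2" by simp
  ultimately show ?thesis using m by simp
qed

text \<open>Such edges separate \<open>a\<close> from \<open>- a\<close>. The strict bounds rule out
  edges at these two points, and each edge is named in one order only, with \<open>x\<close> on the
  half circle after \<open>a\<close>.\<close>

definition crosses :: "complex \<Rightarrow> complex \<Rightarrow> complex \<Rightarrow> bool" where
  "crosses a x y \<longleftrightarrow> 0 < ang a x \<and> ang a x < pi \<and> pi < ang a y"

text \<open>The points of the open half circle after \<open>a\<close>, apart from the partners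
  \<open>b\<close> of \<open>a\<close> and \<open>z\<close> of \<open>- a\<close>, are matched among
  themselves. Their number \<open>m - 1\<close>, partners included, is even, so \<open>b\<close> and
  \<open>z\<close> lie there together or not at all; then flipping their edges creates the
  diameter.\<close>

lemma reach_diameter_uncrossed:
  assumes P: "antipodal P" "a \<in> P" and m: "card P = 2 * m" "odd m" and M: "nc_matching P M"
    and nocross: "\<And>x y. {x, y} \<in> M \<Longrightarrow> \<not> crosses a x y"
  obtains N where "equivclp (flip_step P) M N" "{a, - a} \<in> N"
proof -
  have PS: "P \<subseteq> sphere 0 1" and finP: "finite P" using P by (simp_all add: antipodal_def)
  have na: "norm a = 1" using P antipodal_norm by blast
  have n: "norm z = 1" if "z \<in> P" for z using that P antipodal_norm by blast
  have aa: "ang a a = 0" using ang_self[OF na] .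
  have am: "ang a (- a) = pi" using ang_uminus[OF na na] aa by simp
  have mP: "- a \<in> P" using P by (auto simp: antipodal_def)
  have pos: "0 < ang a w" if "w \<in> P" "w \<noteq> a" for w
    using ang_inject[OF na n[OF that(1)] na] that(2) aa ang_ge_0[of a w] by linarith
  have npi: "ang a w \<noteq> pi" if "w \<in> P" "w \<noteq> - a" for w
    using ang_inject[OF na n[OF that(1)], of "- a"] that(2) am na by simp
  obtain b where b: "{a, b} \<in> M" by (rule nc_matching_partner[OF M P(2)])
  obtain z where z: "{- a, z} \<in> M" by (rule nc_matching_partner[OF M mP])
  show thesis
  proof (cases "b = - a")
    case True
    then show thesis using that[of M] b by (simp add: equivclp_def)
  next
    case False
    have bP: "b \<in> P" "b \<noteq> a" and zP: "z \<in> P" "z \<noteq> - a"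
      using nc_matching_in[OF M b] nc_matching_in[OF M z] by auto
    have "a \<noteq> - a" using aa am by auto
    then have ne: "{a, b} \<noteq> {- a, z}" using False by (simp add: doubleton_eq_iff)
    note bz = nc_matching_disj[OF M PS na b z ne]
    let ?L = "{w \<in> P. 0 < ang a w \<and> ang a w < pi}"
    define N where "N = {e \<in> M. e \<subseteq> ?L}"
    have "\<Union>N = ?L - {b, z}"
    proof (intro equalityI subsetI)
      fix w assume "w \<in> \<Union>N"
      then obtain e where e: "e \<in> M" "e \<subseteq> ?L" "w \<in> e" by (auto simp: N_def)
      have "a \<notin> e" "- a \<notin> e" using e(2) aa am by auto
      then have "e \<inter> {a, b} = {}" "e \<inter> {- a, z} = {}"
        using nc_matching_disjoint[OF M e(1) b] nc_matching_disjoint[OF M e(1) z] by blast+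
      then show "w \<in> ?L - {b, z}" using e by blast
    next
      fix w assume w: "w \<in> ?L - {b, z}"
      then have wP: "w \<in> P" "w \<noteq> a" "w \<noteq> - a" using aa am by auto
      obtain w' where w': "{w, w'} \<in> M" by (rule nc_matching_partner[OF M wP(1)])
      have w'P: "w' \<in> P" using nc_matching_in[OF M w'] by auto
      have "{w, w'} \<noteq> {a, b}" "{w, w'} \<noteq> {- a, z}" using w wP by (auto simp: doubleton_eq_iff)
      from nc_matching_disj[OF M PS na w' b this(1)] nc_matching_disj[OF M PS na w' z this(2)]
      have "w' \<noteq> a" "w' \<noteq> - a" by auto
      then have "0 < ang a w'" "ang a w' \<noteq> pi" using pos npi w'P by auto
      moreover have "\<not> pi < ang a w'" using nocross[OF w'] w by (auto simp: crosses_def)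
      ultimately have "w' \<in> ?L" using w'P by simp
      then have "{w, w'} \<in> N" using w w' by (simp add: N_def)
      then show "w \<in> \<Union>N" by blast
    qed
    then have evn: "even (card (?L - {b, z}))" using even_card_Union[OF finP M, of N] by (simp add: N_def)
    have od: "odd (card (?L - {s}))" if "s \<in> ?L" for s
    proof -
      have "Suc (card (?L - {s})) = m - 1"
        using card_Suc_Diff1[OF _ that] card_half_circle[OF P m(1)] finP by simp
      moreover have "even (m - 1)" using m(2) by simp
      ultimately show ?thesis by (metis even_Suc)
    qed
    have parity: "b \<in> ?L \<longleftrightarrow> z \<in> ?L"
    proof (rule ccontr)
      assume "\<not> (b \<in> ?L \<longleftrightarrow> z \<in> ?L)"
      then consider "b \<in> ?L" "?L - {b, z} = ?L - {b}" | "z \<in> ?L" "?L - {b, z} = ?L - {z}" by blast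
      then show False
      proof cases
        case 1
        show False using od[OF 1(1)] evn unfolding 1(2) by contradiction
      next
        case 2
        show False using od[OF 2(1)] evn unfolding 2(2) by contradiction
      qed
    qed
    \<comment> \<open>An edge with \<open>z\<close> on its arc has \<open>- a\<close> there too; as
      it does not start at \<open>a\<close>, it would be a crossing edge.\<close>
    have sep: "\<not> in_arc (ang a u) (ang a v) (ang a z)"
      if uv: "{u, v} \<in> M" "{u, v} \<noteq> {a, b}" "{u, v} \<noteq> {- a, z}" "ang a u < ang a v" for u v
    proof
      assume "in_arc (ang a u) (ang a v) (ang a z)"
      then have "in_arc (ang a u) (ang a v) (ang a (- a))"
        using nc_matching_disj[OF M PS na uv(1) z uv(3)] by blast
      moreover have "u \<noteq> a" using nc_matching_disj[OF M PS na uv(1) b uv(2)] by blast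
      then have "0 < ang a u" using pos nc_matching_in[OF M uv(1)] by blast
      ultimately show False using nocross[OF uv(1)] uv(4) am by (auto simp: crosses_def in_arc_def)
    qed
    have at_a: "\<not> in_arc (ang a u) (ang a v) (ang a a)" if "ang a u < ang a v" for u v
      using that aa ang_ge_0[of a u] by (auto simp: in_arc_def)
    show thesis
    proof (cases "b \<in> ?L")
      case True
      have "flip_step P M (M - {{a, b}, {z, - a}} \<union> {{b, z}, {- a, a}})"
      proof (rule flip_step_quad[OF M PS na])
        have "z \<in> ?L" using True parity by blast
        moreover have "\<not> in_arc (ang a a) (ang a b) (ang a z)" using bz am aa True by (auto simp: in_arc_def)
        moreover have "ang a b \<noteq> ang a z" using ang_inject[OF na n n] bP zP bz by blast
        ultimately show "ang a a < ang a b" "ang a b < ang a z" "ang a z < ang a (- a)"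
          using True aa am by (auto simp: in_arc_def)
        show "{{a, b}, {z, - a}} \<subseteq> M" using b z by (simp add: insert_commute)
        show "0 \<in> convex hull {a, b, z, - a}" by (rule zero_in_hull[of a]) auto
        fix u v assume uv: "{u, v} \<in> M - {{a, b}, {z, - a}}" "ang a u < ang a v"
        then have "{u, v} \<in> M" "{u, v} \<noteq> {a, b}" "{u, v} \<noteq> {- a, z}" by (auto simp: insert_commute)
        from sep[OF this uv(2)] at_a[OF uv(2)]
        show "in_arc (ang a u) (ang a v) (ang a a) = in_arc (ang a u) (ang a v) (ang a z)" by simp
      qed simp
      then have "equivclp (flip_step P) M (M - {{a, b}, {z, - a}} \<union> {{b, z}, {- a, a}})" by (rule r_into_equivclp)
      then show thesis by (rule that) (simp add: insert_commute)
    next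
      case nb: False
      have "z \<noteq> a" using bz by blast
      then have b': "pi < ang a b" and z': "pi < ang a z"
        using nb parity pos[OF bP] npi[OF bP(1) False] pos[OF zP(1)] npi[OF zP] bP(1) zP(1)
        by (simp_all add: not_less)
      have "flip_step P M (M - {{- a, z}, {b, a}} \<union> {{a, - a}, {z, b}})"
      proof (rule flip_step_quad[OF M PS na])
        have "in_arc (ang a a) (ang a b) (ang a z)" using bz am aa b' by (auto simp: in_arc_def)
        then show "ang a a < ang a (- a)" "ang a (- a) < ang a z" "ang a z < ang a b"
          using aa am z' b' ang_ge_0[of a z] by (auto simp: in_arc_def)
        show "{{- a, z}, {b, a}} \<subseteq> M" using b z by (simp add: insert_commute)
        show "0 \<in> convex hull {a, - a, z, b}" by (rule zero_in_hull[of a]) auto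
        fix u v assume uv: "{u, v} \<in> M - {{- a, z}, {b, a}}" "ang a u < ang a v"
        then have "{u, v} \<in> M" "{u, v} \<noteq> {a, b}" "{u, v} \<noteq> {- a, z}" by (auto simp: insert_commute)
        from sep[OF this uv(2)] at_a[OF uv(2)]
        show "in_arc (ang a u) (ang a v) (ang a a) = in_arc (ang a u) (ang a v) (ang a z)" by simp
      qed simp
      then have "equivclp (flip_step P) M (M - {{- a, z}, {b, a}} \<union> {{a, - a}, {z, b}})" by (rule r_into_equivclp)
      then show thesis by (rule that) simp
    qed
  qed
qed

text \<open>The crossing edge \<open>{x, y}\<close> with the smallest angle at \<open>x\<close> is
  flipped with the edge at \<open>a\<close>; by \<open>vis\<close> the triangle \<open>a\<close>,
  \<open>x\<close>, \<open>y\<close> contains the centre. One new edge ends at \<open>a\<close>, the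
  other stays on one side of the diameter, so no crossing edge arises.\<close>

lemma uncross:
  assumes P: "antipodal P" "a \<in> P" and M: "nc_matching P M"
    and vis: "\<forall>x y. {x, y} \<in> M \<longrightarrow> crosses a x y \<longrightarrow> ang a y - ang a x \<le> pi"
    and ex: "\<exists>x y. {x, y} \<in> M \<and> crosses a x y"
  obtains x y E E' where "flip_step P M (M - E \<union> E')" "{x, y} \<in> E" "{x, y} \<in> M" "crosses a x y"
    "\<forall>u v. {u, v} \<in> E' \<longrightarrow> \<not> crosses a u v"
proof -
  have PS: "P \<subseteq> sphere 0 1" and finP: "finite P" using P by (simp_all add: antipodal_def)
  have na: "norm a = 1" using P antipodal_norm by blast
  have n: "norm z = 1" if "z \<in> P" for z using that P antipodal_norm by blast
  have aa: "ang a a = 0" using ang_self[OF na] .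
  have pos: "0 < ang a w" if "w \<in> P" "w \<noteq> a" for w
    using ang_inject[OF na n[OF that(1)] na] that(2) aa ang_ge_0[of a w] by linarith
  define X where "X = {x \<in> P. \<exists>y. {x, y} \<in> M \<and> crosses a x y}"
  have X: "finite X" using finP by (simp add: X_def)
  have X': "X \<noteq> {}" using ex nc_matching_in(1)[OF M] unfolding X_def by blast
  define x where "x = arg_min_on (ang a) X"
  have x: "x \<in> X" "\<And>w. w \<in> X \<Longrightarrow> ang a x \<le> ang a w"
    using arg_min_if_finite[OF X X', of "ang a"] unfolding x_def by (auto simp: not_less)
  then obtain y where xy: "{x, y} \<in> M" "crosses a x y" by (auto simp: X_def)
  then have xy': "0 < ang a x" "ang a x < pi" "pi < ang a y" by (auto simp: crosses_def)
  have xyP: "x \<in> P" "y \<in> P" using nc_matching_in[OF M xy(1)] by auto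
  obtain b where b: "{a, b} \<in> M" by (rule nc_matching_partner[OF M P(2)])
  have bP: "b \<in> P" "b \<noteq> a" using nc_matching_in[OF M b] by auto
  have "x \<noteq> a" "y \<noteq> a" using xy' aa by auto
  then have ne: "{a, b} \<noteq> {x, y}" by (auto simp: doubleton_eq_iff)
  note bxy = nc_matching_disj[OF M PS na b xy(1) ne]
  have b0: "0 < ang a b" using pos bP by blast
  have bx: "ang a b \<noteq> ang a x" "ang a b \<noteq> ang a y" using ang_inject[OF na n n] bP xyP bxy by blast+
  \<comment> \<open>An edge with \<open>x\<close> on its arc has \<open>y\<close> there too, so it
    crosses and starts before \<open>x\<close>, against the choice of \<open>x\<close>.\<close>
  have sep: "\<not> in_arc (ang a u) (ang a v) (ang a x)" "\<not> in_arc (ang a u) (ang a v) (ang a y)"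
    if uv: "{u, v} \<in> M" "{u, v} \<noteq> {a, b}" "{u, v} \<noteq> {x, y}" "ang a u < ang a v" for u v
  proof -
    note d = nc_matching_disj[OF M PS na uv(1) xy(1) uv(3)]
    have "u \<noteq> a" using nc_matching_disj[OF M PS na uv(1) b uv(2)] by blast
    then have u: "0 < ang a u" "u \<in> P" using pos nc_matching_in[OF M uv(1)] by auto
    show *: "\<not> in_arc (ang a u) (ang a v) (ang a x)"
    proof
      assume in_arc: "in_arc (ang a u) (ang a v) (ang a x)"
      with d have "in_arc (ang a u) (ang a v) (ang a y)" by blast
      with in_arc have "crosses a u v" "ang a u < ang a x" using uv(4) u xy' by (auto simp: in_arc_def crosses_def)
      then show False using x(2)[of u] u uv(1) by (auto simp: X_def)
    qed
    with d show "\<not> in_arc (ang a u) (ang a v) (ang a y)" by blast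
  qed
  have at_a: "\<not> in_arc (ang a u) (ang a v) (ang a a)" if "ang a u < ang a v" for u v
    using that aa ang_ge_0[of a u] by (auto simp: in_arc_def)
  have "0 \<in> convex hull {a * cis (ang a a), a * cis (ang a x), a * cis (ang a y)}"
    using xy' aa vis xy by (intro zero_in_triangle) auto
  then have "0 \<in> convex hull {a, x, y}"
    unfolding cis_ang[OF na na, symmetric] cis_ang[OF na n[OF xyP(1)], symmetric]
      cis_ang[OF na n[OF xyP(2)], symmetric] .
  moreover have "convex hull {a, x, y} \<subseteq> convex hull {a, b, x, y}"
    "convex hull {a, x, y} \<subseteq> convex hull {a, x, y, b}" by (rule hull_mono; auto)+
  ultimately have zero: "0 \<in> convex hull {a, b, x, y}" "0 \<in> convex hull {a, x, y, b}" by blast+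
  show thesis
  proof (cases "ang a b < ang a x")
    case True
    have "flip_step P M (M - {{a, b}, {x, y}} \<union> {{b, x}, {y, a}})"
    proof (rule flip_step_quad[OF M PS na])
      show "ang a a < ang a b" "ang a b < ang a x" "ang a x < ang a y" using True b0 aa xy' by auto
      show "{{a, b}, {x, y}} \<subseteq> M" using b xy by simp
      fix u v assume uv: "{u, v} \<in> M - {{a, b}, {x, y}}" "ang a u < ang a v"
      then have "{u, v} \<in> M" "{u, v} \<noteq> {a, b}" "{u, v} \<noteq> {x, y}" by auto
      from sep[OF this uv(2)] at_a[OF uv(2)]
      show "in_arc (ang a u) (ang a v) (ang a a) = in_arc (ang a u) (ang a v) (ang a x)" by simp
    qed (simp_all add: zero)
    moreover have "\<forall>u v. {u, v} \<in> {{b, x}, {y, a}} \<longrightarrow> \<not> crosses a u v"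
      using True xy' aa by (auto simp: doubleton_eq_iff crosses_def)
    ultimately show thesis using xy by (intro that[of "{{a, b}, {x, y}}" "{{b, x}, {y, a}}" x y]) simp_all
  next
    case False
    \<comment> \<open>\<open>{a, b}\<close> does not meet \<open>{x, y}\<close>, so \<open>b\<close>
      cannot lie between \<open>x\<close> and \<open>y\<close>.\<close>
    then have "ang a y < ang a b" using bxy bx b0 aa xy' by (auto simp: in_arc_def)
    have "flip_step P M (M - {{x, y}, {b, a}} \<union> {{a, x}, {y, b}})"
    proof (rule flip_step_quad[OF M PS na])
      show "ang a a < ang a x" "ang a x < ang a y" "ang a y < ang a b" using aa xy' \<open>ang a y < ang a b\<close> by auto
      show "{{x, y}, {b, a}} \<subseteq> M" using b xy by (simp add: insert_commute)
      fix u v assume uv: "{u, v} \<in> M - {{x, y}, {b, a}}" "ang a u < ang a v"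
      then have "{u, v} \<in> M" "{u, v} \<noteq> {a, b}" "{u, v} \<noteq> {x, y}" by (auto simp: insert_commute)
      from sep[OF this uv(2)] at_a[OF uv(2)]
      show "in_arc (ang a u) (ang a v) (ang a a) = in_arc (ang a u) (ang a v) (ang a y)" by simp
    qed (simp_all add: zero)
    moreover have "\<forall>u v. {u, v} \<in> {{a, x}, {y, b}} \<longrightarrow> \<not> crosses a u v"
      using xy' aa \<open>ang a y < ang a b\<close> by (auto simp: doubleton_eq_iff crosses_def)
    ultimately show thesis using xy by (intro that[of "{{x, y}, {b, a}}" "{{a, x}, {y, b}}" x y]) simp_all
  qed
qed

text \<open>Induction on the number of crossing edges. The new edges of a flip do not cross, so
  \<open>vis\<close> is inherited.\<close>

lemma reach_diameter_visible:
  assumes P: "antipodal P" "a \<in> P" and m: "card P = 2 * m" "odd m" and M: "nc_matching P M"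
    and vis: "\<forall>x y. {x, y} \<in> M \<longrightarrow> crosses a x y \<longrightarrow> ang a y - ang a x \<le> pi"
  shows "\<exists>N. equivclp (flip_step P) M N \<and> {a, - a} \<in> N"
  using M vis
proof (induction "card {e \<in> M. \<exists>x y. e = {x, y} \<and> crosses a x y}" arbitrary: M rule: less_induct)
  case less
  let ?C = "\<lambda>M. {e \<in> M. \<exists>x y. e = {x, y} \<and> crosses a x y}"
  show ?case
  proof (cases "\<exists>x y. {x, y} \<in> M \<and> crosses a x y")
    case False
    then show ?thesis using reach_diameter_uncrossed[OF P m less.prems(1)] by blast
  next
    case True
    obtain x y E E' where E: "flip_step P M (M - E \<union> E')" "{x, y} \<in> E" "{x, y} \<in> M" "crosses a x y"
      "\<forall>u v. {u, v} \<in> E' \<longrightarrow> \<not> crosses a u v"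
      by (rule uncross[OF P less.prems True])
    let ?M = "M - E \<union> E'"
    have "finite (?C M)" using finite_nc_matching[of P M] P less.prems by (simp add: antipodal_def)
    moreover have "?C ?M \<subseteq> ?C M" "{x, y} \<in> ?C M" "{x, y} \<notin> ?C ?M" using E by auto
    ultimately have "card (?C ?M) < card (?C M)" by (intro psubset_card_mono) blast+
    moreover have "nc_matching P ?M" using E(1) by (simp add: flip_step_def)
    moreover have "\<forall>u v. {u, v} \<in> ?M \<longrightarrow> crosses a u v \<longrightarrow> ang a v - ang a u \<le> pi"
      using less.prems(2) E(5) by blast
    ultimately obtain N where "equivclp (flip_step P) ?M N" "{a, - a} \<in> N" using less.hyps by blast
    with E(1) show ?thesis by (meson equivclp_trans r_into_equivclp)
  qed
qed

text \<open>The endpoints of a longest edge are not hidden from the centre by another edge.\<close>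

lemma reach_some_diameter:
  assumes P: "antipodal P" and m: "card P = 2 * m" "odd m" and M: "nc_matching P M"
  obtains a N where "a \<in> P" "equivclp (flip_step P) M N" "{a, - a} \<in> N"
proof -
  have PS: "P \<subseteq> sphere 0 1" and finP: "finite P" using P by (simp_all add: antipodal_def)
  have n: "norm z = 1" if "z \<in> P" for z using that P antipodal_norm by blast
  define S where "S = {(x, y) \<in> P \<times> P. {x, y} \<in> M}"
  have "P \<noteq> {}" using m by auto
  then obtain p where p: "p \<in> P" by blast
  obtain p' where "{p, p'} \<in> M" by (rule nc_matching_partner[OF M p])
  then have "(p, p') \<in> S" using p nc_matching_in(2)[OF M] by (simp add: S_def)
  then have S: "S \<noteq> {}" by blast
  have fS: "finite S" using finP by (auto simp: S_def intro: finite_subset[of _ "P \<times> P"])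
  \<comment> \<open>The inner product, that is, the cosine of the central angle: smallest on a
    longest edge.\<close>
  define f where "f = (\<lambda>(x, y). Re (x * cnj y))"
  obtain a b where ab: "(a, b) = arg_min_on f S" by (metis surj_pair)
  have ab: "(a, b) \<in> S" and min: "\<And>s. s \<in> S \<Longrightarrow> f (a, b) \<le> f s"
    using arg_min_if_finite[OF fS S, of f] ab by (auto simp: not_less)
  then have aP: "a \<in> P" "b \<in> P" "{a, b} \<in> M" by (auto simp: S_def)
  have na: "norm a = 1" using n aP by blast
  have aa: "ang a a = 0" using ang_self[OF na] .
  have cos: "Re (x * cnj y) = cos (ang a y - ang a x)" if "x \<in> P" "y \<in> P" for x y
  proof -
    have "x * cnj y = (a * cis (ang a x)) * cnj (a * cis (ang a y))"
      using cis_ang[OF na n] that by metis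
    also have "\<dots> = (a * cnj a) * (cis (ang a x) * cnj (cis (ang a y)))" by (simp add: mult_ac)
    also have "a * cnj a = 1" using na by (simp add: complex_norm_square[symmetric])
    finally show ?thesis by (simp add: cos_diff)
  qed
  have vis: "ang a y - ang a x \<le> pi" if xy: "{x, y} \<in> M" "crosses a x y" for x y
  proof (rule ccontr)
    assume *: "\<not> ang a y - ang a x \<le> pi"
    have x: "0 < ang a x" "ang a x < pi" "pi < ang a y" using xy(2) by (auto simp: crosses_def)
    have xyP: "x \<in> P" "y \<in> P" using nc_matching_in[OF M xy(1)] by auto
    have "x \<noteq> a" "y \<noteq> a" using x aa by auto
    then have ne: "{x, y} \<noteq> {a, b}" by (auto simp: doubleton_eq_iff)
    have "\<not> in_arc (ang a x) (ang a y) (ang a a)" using aa x by (auto simp: in_arc_def)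
    then have "\<not> in_arc (ang a x) (ang a y) (ang a b)" "x \<noteq> b" "y \<noteq> b"
      using nc_matching_disj[OF M PS na xy(1) aP(3) ne] by blast+
    moreover have "ang a x \<noteq> ang a b" "ang a y \<noteq> ang a b"
      using ang_inject[OF na n n] aP xyP calculation by blast+
    ultimately have "ang a b < ang a x \<or> ang a y < ang a b" using x by (auto simp: in_arc_def)
    moreover have per: "cos t = cos (2 * pi - t)" for t :: real by (simp add: cos_diff)
    have "ang a y < 2 * pi" "ang a b < 2 * pi" "0 \<le> ang a b" by (simp_all add: ang_lt_2pi ang_ge_0)
    \<comment> \<open>The arc from \<open>x\<close> to \<open>y\<close> that avoids \<open>a\<close>
      exceeds \<open>pi\<close>, so \<open>a\<close> and \<open>b\<close> both lie on the shorter
      complementary arc. Hence \<open>{a, b}\<close> spans a smaller central angle than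
      \<open>{x, y}\<close>, whose angle is \<open>2 * pi - (ang a y - ang a x)\<close>.\<close>
    ultimately have "cos (2 * pi - (ang a y - ang a x)) < cos (ang a b)"
    proof (elim disjE)
      assume "ang a b < ang a x"
      then show ?thesis using * x \<open>ang a y < 2 * pi\<close> \<open>0 \<le> ang a b\<close> by (intro cos_monotone_0_pi) auto
    next
      assume "ang a y < ang a b"
      then have "cos (2 * pi - (ang a y - ang a x)) < cos (2 * pi - ang a b)"
        using * x \<open>ang a b < 2 * pi\<close> by (intro cos_monotone_0_pi) auto
      then show ?thesis by (simp only: per[of "ang a b"])
    qed
    then have "cos (ang a y - ang a x) < cos (ang a b - ang a a)"
      by (simp only: per[of "ang a y - ang a x"] aa diff_0_right)
    moreover have "f (a, b) \<le> f (x, y)" by (rule min) (use xy xyP in \<open>simp add: S_def\<close>)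
    ultimately show False using cos[OF xyP] cos[OF aP(1,2)] by (simp add: f_def)
  qed
  have "\<exists>N. equivclp (flip_step P) M N \<and> {a, - a} \<in> N"
    by (rule reach_diameter_visible[OF P aP(1) m M]) (use vis in blast)
  then show thesis using that aP(1) by blast
qed

section \<open>Prescribing the diameter\<close>

lemma ang_diff:
  assumes "norm a = 1" "norm b = 1" "norm z = 1" "ang a b \<le> ang a z"
  shows "ang b z = ang a z - ang a b"
proof -
  have z: "z = a * cis (ang a z)" and b: "b = a * cis (ang a b)" using cis_ang assms by auto
  have "z = b * cis (ang a z - ang a b)"
    using z by (subst b) (simp add: mult.assoc cis_mult)
  moreover have "b \<noteq> 0" using assms by auto
  ultimately have "z / b = cis (ang a z - ang a b)" by (metis nonzero_mult_div_cancel_left)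
  then have "of_real 1 * exp (\<i> * of_real (ang a z - ang a b)) = z / b" by (simp add: cis_conv_exp)
  then show ?thesis
    unfolding ang_def[of b]
    using assms(4) ang_ge_0[of a b] ang_lt_2pi[of a z] by (intro Arg2pi_unique[of 1]) auto
qed

lemma reach_diameter:
  assumes P: "antipodal P" and m: "card P = 2 * m" "odd m" and M: "nc_matching P M" and p: "p \<in> P"
  obtains N where "equivclp (flip_step P) M N" "{p, - p} \<in> N"
proof -
  have n: "norm z = 1" if "z \<in> P" for z using that P antipodal_norm by blast
  define S where "S = {a \<in> P. \<exists>N. equivclp (flip_step P) M N \<and> {a, - a} \<in> N}"
  have fS: "finite S" using P by (simp add: S_def antipodal_def)
  obtain a' N' where "a' \<in> P" "equivclp (flip_step P) M N'" "{a', - a'} \<in> N'"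
    by (rule reach_some_diameter[OF P m M])
  then have S: "S \<noteq> {}" unfolding S_def by blast
  \<comment> \<open>Among the reachable diameters the one with the smallest counterclockwise angle
    from \<open>a\<close> to \<open>p\<close> is chosen. Unless \<open>p\<close> is \<open>a\<close>
    or \<open>- a\<close>, rotating to the neighbour \<open>b\<close> would shorten it by
    \<open>ang a b\<close>.\<close>
  define a where "a = arg_min_on (\<lambda>a. ang a p) S"
  have a: "a \<in> S" "\<And>w. w \<in> S \<Longrightarrow> ang a p \<le> ang w p"
    using arg_min_if_finite[OF fS S, of "\<lambda>a. ang a p"] unfolding a_def by (auto simp: not_less)
  then obtain N where N: "a \<in> P" "equivclp (flip_step P) M N" "{a, - a} \<in> N" by (auto simp: S_def)
  have "p = a \<or> p = - a"
  proof (rule ccontr)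
    assume np: "\<not> (p = a \<or> p = - a)"
    then have "P \<noteq> {a, - a}" using p by blast
    then obtain b where b: "next_point P a b" by (rule next_point_exists[OF P N(1)])
    have ncN: "nc_matching P N" by (rule nc_matching_equivclp[OF N(2) M])
    obtain N' where "equivclp (flip_step P) N N'" "{b, - b} \<in> N'"
      by (rule rotate_diameter[OF P ncN b N(3)])
    then have "b \<in> S" using b equivclp_trans[OF N(2)] unfolding S_def next_point_def by blast
    then have "ang a p \<le> ang b p" by (rule a(2))
    moreover have ab: "ang a b \<le> ang a p" "0 < ang a b" "b \<in> P" using b p np by (auto simp: next_point_def)
    have "ang b p = ang a p - ang a b" using ang_diff[OF n n n ab(1)] N(1) ab(3) p by blast
    ultimately show False using ab by simp
  qed
  then have "{p, - p} \<in> N" using N(3) by (auto simp: insert_commute)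
  with N(2) show thesis by (rule that)
qed

section \<open>Removing antipodal ears\<close>

abbreviation ears :: "complex \<Rightarrow> complex \<Rightarrow> complex set set" where
  "ears a b \<equiv> {{a, b}, {- a, - b}}"

text \<open>No point of \<open>P\<close> lies between \<open>a\<close> and its neighbour
  \<open>b\<close>, so \<open>S\<close> is on one side of the line through them; the half turn gives
  the other ear.\<close>

lemma ear_apart:
  assumes P: "antipodal P" and ab: "next_point P a b" and e: "e \<in> ears a b"
    and S: "S \<subseteq> P - {a, b, - a, - b}"
  shows "convex hull e \<inter> convex hull S = {}"
proof -
  have *: "convex hull {a, b} \<inter> convex hull S = {}"
    if ab: "next_point P a b" and S: "S \<subseteq> P - {a, b, - a, - b}" for a b
  proof -
    note nx = next_point_ang[OF P ab]
    have "affine hull {a, b} \<inter> convex hull S = {}"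
    proof (rule chord_hull_disjoint[OF nx(1,1,2)])
      show "a \<noteq> b" using ab nx(3) by (auto simp: next_point_def)
      show "S \<subseteq> sphere 0 1" using S P by (auto simp: antipodal_def)
      have "\<not> in_arc (ang a a) (ang a b) (ang a z)" if "z \<in> S" for z
        using ab that S nx(3) ang_ge_0[of a b] by (force simp: next_point_def in_arc_def)
      then show "in_arc (ang a a) (ang a b) (ang a z) = in_arc (ang a a) (ang a b) (ang a w)"
        if "z \<in> S" "w \<in> S" for z w using that by simp
    qed (use S in auto)
    then show ?thesis using hull_subset_affine by blast
  qed
  have "S \<subseteq> P - {- a, - b, - (- a), - (- b)}" using S by auto
  from *[OF ab S] *[OF next_point_ang(8)[OF P ab] this] e show ?thesis by auto
qed

lemma ears_disjoint:
  assumes P: "antipodal P" and ab: "next_point P a b"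
  shows "card {a, b, - a, - b} = 4" "convex hull {a, b} \<inter> convex hull {- a, - b} = {}"
proof -
  note nx = next_point_ang[OF P ab]
  have b: "0 < ang a b" "ang a b < pi" using ab by (auto simp: next_point_def)
  have d: "a \<noteq> b" "a \<noteq> - a" "a \<noteq> - b" "b \<noteq> - a" "b \<noteq> - b" "- a \<noteq> - b"
    using b nx(3-5) by (auto simp del: neg_equal_iff_equal equal_neg_zero neg_equal_zero)
  then show "card {a, b, - a, - b} = 4" by simp
  show "convex hull {a, b} \<inter> convex hull {- a, - b} = {}"
    using d b nx by (subst chords_disjoint_iff[OF nx(1)]) (auto simp: in_arc_def)
qed

lemma antipodal_remove:
  assumes "antipodal P"
  shows "antipodal (P - {a, b, - a, - b})"
  using assms unfolding antipodal_def by (auto simp: minus_equation_iff)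

lemma nc_matching_add_ears:
  assumes P: "antipodal P" and ab: "next_point P a b" and N: "nc_matching (P - {a, b, - a, - b}) N"
  shows "nc_matching P (N \<union> ears a b)"
  unfolding nc_matching_def
proof (intro conjI)
  note ed = ears_disjoint[OF P ab]
  have U: "\<Union>N = P - {a, b, - a, - b}" using N by (simp add: nc_matching_def)
  have "{a, b, - a, - b} \<subseteq> P" using ab next_point_ang(6,7)[OF P ab] by (auto simp: next_point_def)
  then show "\<Union>(N \<union> ears a b) = P" using U by auto
  have "a \<noteq> b" using ed(1) by (auto simp: card_insert_if split: if_splits)
  then show "\<forall>e\<in>N \<union> ears a b. card e = 2" using N by (auto simp: nc_matching_def)
  have apart: "convex hull e \<inter> convex hull g = {}" if "e \<in> ears a b" "g \<in> N" for e g
    by (rule ear_apart[OF P ab that(1)]) (use that(2) U in blast)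
  have ee: "convex hull e \<inter> convex hull g = {}" if "e \<in> ears a b" "g \<in> ears a b" "e \<noteq> g" for e g
    using that ed(2) by (auto simp: Int_commute)
  show "noncrossing (N \<union> ears a b)"
    unfolding noncrossing_def
  proof (intro ballI impI)
    fix g h assume gh: "g \<in> N \<union> ears a b" "h \<in> N \<union> ears a b" "g \<noteq> h"
    consider "g \<in> N" "h \<in> N" | "g \<in> N" "h \<in> ears a b" | "g \<in> ears a b" "h \<in> N" | "g \<in> ears a b" "h \<in> ears a b"
      using gh(1,2) by (elim UnE)
    then show "convex hull g \<inter> convex hull h = {}"
    proof cases
      case 1
      then show ?thesis using N gh(3) unfolding nc_matching_def noncrossing_def by blast
    next
      case 2
      then show ?thesis using apart[of h g] by (simp only: Int_commute)
    next
      case 3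
      then show ?thesis by (rule apart)
    next
      case 4
      then show ?thesis using gh(3) by (rule ee)
    qed
  qed
qed

lemma nc_matching_remove_ears:
  assumes M: "nc_matching P M" and e: "{a, b} \<in> M" "{- a, - b} \<in> M"
  shows "nc_matching (P - {a, b, - a, - b}) (M - ears a b)"
  unfolding nc_matching_def
proof (intro conjI)
  have U: "\<Union>M = P" using M by (simp add: nc_matching_def)
  have "g \<inter> {a, b, - a, - b} = {}" if "g \<in> M - ears a b" for g
    using nc_matching_disjoint[OF M _ e(1), of g] nc_matching_disjoint[OF M _ e(2), of g] that by auto
  then show "\<Union>(M - ears a b) = P - {a, b, - a, - b}" using U by fastforce
  show "\<forall>e\<in>M - ears a b. card e = 2" using M by (simp add: nc_matching_def)
  show "noncrossing (M - ears a b)" using M unfolding nc_matching_def noncrossing_def by blast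
qed

text \<open>The ears miss the quadrilateral and are not among the exchanged edges, so the same flip
  works in their presence.\<close>

lemma flip_step_add_ears:
  assumes P: "antipodal P" and ab: "next_point P a b"
    and step: "flip_step (P - {a, b, - a, - b}) N N'"
  shows "flip_step P (N \<union> ears a b) (N' \<union> ears a b)"
proof -
  have N: "nc_matching (P - {a, b, - a, - b}) N" and N': "nc_matching (P - {a, b, - a, - b}) N'"
    using step by (auto simp: flip_step_def)
  obtain e f where ef: "empty_quad N e f" "0 \<in> quadrilateral e f" "N' = flip N e f"
    using step by (auto simp: flip_step_def centered_flip_def)
  have efN: "e \<in> N" "f \<in> N" "e \<noteq> f" using ef by (auto simp: empty_quad_def)
  have sub: "e \<union> f \<subseteq> P - {a, b, - a, - b}" using efN N by (auto simp: nc_matching_def)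
  have "e \<noteq> {}" "f \<noteq> {}" using efN N by (auto simp: nc_matching_def)
  with sub have "e \<notin> ears a b" "f \<notin> ears a b" by auto
  then have "flip (N \<union> ears a b) e f = N' \<union> ears a b"
    unfolding ef(3) flip_def by blast
  moreover have "empty_quad (N \<union> ears a b) e f"
    unfolding empty_quad_def
  proof (intro conjI ballI)
    fix g assume "g \<in> N \<union> ears a b - {e, f}"
    then consider "g \<in> N - {e, f}" | "g \<in> ears a b" by blast
    then show "convex hull g \<inter> quadrilateral e f = {}"
    proof cases
      case 1
      then show ?thesis using ef(1) by (simp add: empty_quad_def)
    next
      case 2
      then show ?thesis by (rule ear_apart[OF P ab _ sub])
    qed
  qed (use efN in simp_all)
  ultimately have "centered_flip (N \<union> ears a b) (N' \<union> ears a b)"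
    using ef(2) unfolding centered_flip_def by metis
  then show ?thesis using nc_matching_add_ears[OF P ab] N N' by (simp add: flip_step_def)
qed

lemma equivclp_add_ears:
  assumes P: "antipodal P" and ab: "next_point P a b"
    and "equivclp (flip_step (P - {a, b, - a, - b})) N N'"
  shows "equivclp (flip_step P) (N \<union> ears a b) (N' \<union> ears a b)"
  using assms(3)
proof (induction rule: equivclp_induct)
  case base
  show ?case by (simp add: equivclp_def)
next
  case (step M M')
  then have "flip_step P (M \<union> ears a b) (M' \<union> ears a b) \<or> flip_step P (M' \<union> ears a b) (M \<union> ears a b)"
    using flip_step_add_ears[OF P ab] by blast
  then have "equivclp (flip_step P) (M \<union> ears a b) (M' \<union> ears a b)"
    using r_into_equivclp equivclp_sym by metis
  with step.IH show ?case by (rule equivclp_trans)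
qed

text \<open>Passing from \<open>m\<close> to \<open>m - 2\<close> keeps it odd, and every matching
  can be moved to one with the ears at a fixed \<open>a\<close>. Existence is carried along since
  connectedness demands a nonempty vertex set.\<close>

lemma flip_graph_connected:
  assumes "antipodal P" "card P = 2 * m" "odd m"
  shows "(\<exists>M. nc_matching P M) \<and>
    (\<forall>M N. nc_matching P M \<longrightarrow> nc_matching P N \<longrightarrow> equivclp (flip_step P) M N)"
  using assms
proof (induction m arbitrary: P rule: less_induct)
  case (less m)
  note P = less.prems(1)
  have finP: "finite P" using P by (simp add: antipodal_def)
  have "P \<noteq> {}" using less.prems by auto
  then obtain a where a: "a \<in> P" by blast
  have ma: "- a \<in> P" using P a by (simp add: antipodal_def)
  have "norm a = 1" using P a antipodal_norm by blast
  then have "a \<noteq> 0" by auto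
  then have "a \<noteq> - a" by simp
  show ?case
  proof (cases "P = {a, - a}")
    case True
    have "noncrossing {P}" by (simp add: noncrossing_def)
    then have "nc_matching P {P}" using True \<open>a \<noteq> - a\<close> by (simp add: nc_matching_def)
    moreover have "M = {P}" if M: "nc_matching P M" for M
    proof -
      have "e = P" if "e \<in> M" for e
      proof (rule card_subset_eq[OF finP])
        show "e \<subseteq> P" using that M by (auto simp: nc_matching_def)
        show "card e = card P" using that M True \<open>a \<noteq> - a\<close> by (simp add: nc_matching_def)
      qed
      moreover have "M \<noteq> {}" using M \<open>P \<noteq> {}\<close> by (auto simp: nc_matching_def)
      ultimately show ?thesis by blast
    qed
    ultimately show ?thesis by (metis equivp_evquivclp equivp_reflp)
  next
    case False
    obtain b where ab: "next_point P a b" by (rule next_point_exists[OF P a False])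
    let ?P = "P - {a, b, - a, - b}"
    have sub: "{a, b, - a, - b} \<subseteq> P" using ab next_point_ang(6,7)[OF P ab] by (auto simp: next_point_def)
    note c4 = ears_disjoint(1)[OF P ab]
    \<comment> \<open>This guards the truncated subtraction in \<open>m - 2\<close>.\<close>
    have "card P \<ge> 4" using card_mono[OF finP sub] c4 by simp
    then have m: "m - 2 < m" "odd (m - 2)" "card ?P = 2 * (m - 2)"
      using less.prems(2,3) card_Diff_subset[OF _ sub] c4 by auto
    note IH = less.IH[OF m(1) antipodal_remove[OF P] m(3,2)]
    have ears: "\<exists>M'. equivclp (flip_step P) M (M' \<union> ears a b) \<and> nc_matching ?P M'"
      if M: "nc_matching P M" for M
    proof -
      obtain N where N: "equivclp (flip_step P) M N" "{a, - a} \<in> N"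
        by (rule reach_diameter[OF P less.prems(2,3) M a])
      have "nc_matching P N" by (rule nc_matching_equivclp[OF N(1) M])
      then obtain N' where N': "equivclp (flip_step P) N N'" "{a, b} \<in> N'" "{- a, - b} \<in> N'"
        by (rule diameter_to_ears[OF P _ ab N(2)])
      have "nc_matching P N'" by (rule nc_matching_equivclp[OF equivclp_trans[OF N(1) N'(1)] M])
      then have "nc_matching ?P (N' - ears a b)" using N' by (intro nc_matching_remove_ears)
      moreover have "N' - ears a b \<union> ears a b = N'" using N' by blast
      moreover have "equivclp (flip_step P) M N'" by (rule equivclp_trans[OF N(1) N'(1)])
      ultimately show ?thesis by metis
    qed
    have "\<exists>M. nc_matching P M" using IH nc_matching_add_ears[OF P ab] by blast
    moreover have "equivclp (flip_step P) M N" if MN: "nc_matching P M" "nc_matching P N" for M N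
    proof -
      obtain M' N' where M': "equivclp (flip_step P) M (M' \<union> ears a b)" "nc_matching ?P M'"
        and N': "equivclp (flip_step P) N (N' \<union> ears a b)" "nc_matching ?P N'"
        using ears[OF MN(1)] ears[OF MN(2)] by blast
      have "equivclp (flip_step P) (M' \<union> ears a b) (N' \<union> ears a b)"
        using IH M'(2) N'(2) by (intro equivclp_add_ears[OF P ab]) blast
      then show ?thesis using M'(1) equivclp_sym[OF N'(1)] equivclp_trans by metis
    qed
    ultimately show ?thesis by blast
  qed
qed

section \<open>The regular polygon and its flip graph\<close>

lemma antipodal_circle_points:
  assumes "n > 0"
  shows "antipodal (circle_points n)" "card (circle_points n) = 2 * n"
proof -
  let ?c = "\<lambda>k. cis (2 * pi * real k / real (2 * n))"
  have neg: "- ?c k = ?c (k + n)" for k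
  proof -
    have "2 * pi * real (k + n) / real (2 * n) = 2 * pi * real k / real (2 * n) + pi"
      using assms by (simp add: field_simps)
    then show ?thesis by (simp add: cis_mult[symmetric])
  qed
  show "antipodal (circle_points n)"
    unfolding antipodal_def
  proof (intro conjI ballI)
    show "finite (circle_points n)" "circle_points n \<subseteq> sphere 0 1" by (auto simp: circle_points_def)
    fix z assume "z \<in> circle_points n"
    then obtain k where k: "k < 2 * n" "z = ?c k" by (auto simp: circle_points_def)
    show "- z \<in> circle_points n"
    proof (cases "k < n")
      case True
      then have "- z = ?c (k + n)" "k + n < 2 * n" using k neg by auto
      then show ?thesis unfolding circle_points_def by (intro image_eqI[of _ _ "k + n"]) auto
    next
      case False
      then have "z = - ?c (k - n)" using k neg[of "k - n"] by simp
      then have "- z = ?c (k - n)" "k - n < 2 * n" using k by auto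
      then show ?thesis unfolding circle_points_def by (intro image_eqI[of _ _ "k - n"]) auto
    qed
  qed
  have "inj_on ?c {..<2 * n}"
  proof (rule inj_onI)
    fix j k assume jk: "j \<in> {..<2 * n}" "k \<in> {..<2 * n}" "?c j = ?c k"
    \<comment> \<open>For indices below \<open>2 * n\<close> the angle is below
      \<open>2 * pi\<close>, so it can be recovered from the point, which gives injectivity.\<close>
    have arg: "Arg2pi (?c i) = 2 * pi * real i / real (2 * n)" if "i < 2 * n" for i
    proof (rule Arg2pi_unique[of 1])
      have "real i / real (2 * n) < 1" using that by simp
      then have "2 * pi * (real i / real (2 * n)) < 2 * pi * 1" by (intro mult_strict_left_mono) auto
      then show "2 * pi * real i / real (2 * n) < 2 * pi" by simp
    qed (simp_all add: cis_conv_exp)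
    then have "2 * pi * real j / real (2 * n) = 2 * pi * real k / real (2 * n)"
      using jk by (metis lessThan_iff)
    then show "j = k" using assms by simp
  qed
  then show "card (circle_points n) = 2 * n" by (simp add: circle_points_def card_image)
qed

theorem theorem6:
  fixes n :: nat
  assumes "odd n" and "n \<ge> 3"
  shows "Digraph_Component.connected (with_proj (centered_flip_graph n))"
proof -
  let ?P = "circle_points n"
  let ?G = "with_proj (centered_flip_graph n)"
  let ?H = "with_proj (mk_symmetric ?G)"
  have "antipodal ?P" "card ?P = 2 * n" using antipodal_circle_points assms by auto
  note conn = flip_graph_connected[OF this assms(1)]
  have verts: "verts ?H = matchings n" by (simp add: mk_symmetric_def centered_flip_graph_def)
  have arcs: "arcs_ends ?H = {(M, M'). flip_step ?P M M' \<or> flip_step ?P M' M}"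
    by (auto simp: mk_symmetric_def centered_flip_graph_def arcs_ends_def arc_to_ends_def
        flip_step_def matchings_iff)
  \<comment> \<open>\<open>reachable\<close> stays within the vertices even for the empty walk,
    hence the assumption on \<open>M\<close>.\<close>
  have reach: "M \<rightarrow>\<^sup>*\<^bsub>?H\<^esub> N" if "equivclp (flip_step ?P) M N" "M \<in> matchings n" for M N
    using that
  proof (induction rule: equivclp_induct)
    case base
    then show ?case unfolding reachable_def verts by (rule rtrancl_on_refl)
  next
    case (step N N')
    then have "(N, N') \<in> arcs_ends ?H" unfolding arcs by blast
    moreover have "N' \<in> matchings n" using step.hyps(2) by (auto simp: flip_step_def matchings_iff)
    ultimately show ?case using step unfolding reachable_def verts
      by (metis rtrancl_on_into_rtrancl_on)
  qed
  show ?thesis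
    unfolding Digraph_Component.connected_def strongly_connected_def verts
    using conn reach by (auto simp: matchings_iff)
qed

end
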